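(* For the family of groups $G_n=\mathbb{F}_2^n$ ($n\ge1$), the threshold density for corners satisfies $M(\alpha)\ge\alpha^4$ for every $\alpha\in[0,1]$.
   Context: Corners and $S_d$: for a finite abelian group $G$ with $|G| = N$, a subset $A \subset G\times G$ and $d \in G$, let $S_d = \{(x,y) \in G\times G : (x,y),\,(x+d,y),\,(x,y+d) \in A\}$. The density of $A$ is $|A|/N^2$. Threshold density: for a family of finite abelian groups and $\alpha\in[0,1]$, $M(\alpha)$ is the largest $M \in [0,1]$ such that for every $\epsilon > 0$ there is an $N_0$ such that for all groups $G$ in the family with $|G| = N \ge N_0$ and all subsets $A \subset G\times G$ of density at least $\alpha$, there is a $d \in G\setminus\{0\}$ with $|S_d| > (M-\epsilon)N^2$. *)

theory Defs
  imports Complex_Main "HOL-Algebra.Algebra"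
begin

text \<open>Abelian groups are those of \<^theory>\<open>HOL-Algebra.Group\<close> and hence written
  multiplicatively: the sum \<open>x + d\<close> of the additive notation is \<open>x \<otimes> d\<close>, and \<open>0\<close> is \<open>\<one>\<close>.\<close>

definition corner_set :: "('a, 'b) monoid_scheme \<Rightarrow> ('a \<times> 'a) set \<Rightarrow> 'a \<Rightarrow> ('a \<times> 'a) set" where
  "corner_set G A d =
    {(x, y). x \<in> carrier G \<and> y \<in> carrier G \<and>
       (x, y) \<in> A \<and> (x \<otimes>\<^bsub>G\<^esub> d, y) \<in> A \<and> (x, y \<otimes>\<^bsub>G\<^esub> d) \<in> A}"

definition pair_density :: "('a, 'b) monoid_scheme \<Rightarrow> ('a \<times> 'a) set \<Rightarrow> real" where
  "pair_density G A = real (card A) / real (order G) ^ 2"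

definition popular_corners :: "('a, 'b) monoid_scheme set \<Rightarrow> real \<Rightarrow> real \<Rightarrow> bool" where
  "popular_corners \<G> \<alpha> M \<longleftrightarrow>
    (\<forall>\<epsilon>>0. \<exists>N\<^sub>0. \<forall>G\<in>\<G>. order G \<ge> N\<^sub>0 \<longrightarrow>
      (\<forall>A. A \<subseteq> carrier G \<times> carrier G \<and> pair_density G A \<ge> \<alpha> \<longrightarrow>
        (\<exists>d \<in> carrier G - {\<one>\<^bsub>G\<^esub>}.
           real (card (corner_set G A d)) > (M - \<epsilon>) * real (order G) ^ 2)))"

text \<open>For a family \<open>\<G>\<close> of finite abelian groups; the greatest element exists by
  \<open>threshold_density_greatest\<close> below.\<close>

definition threshold_density :: "('a, 'b) monoid_scheme set \<Rightarrow> real \<Rightarrow> real" where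
  "threshold_density \<G> \<alpha> = (GREATEST M. 0 \<le> M \<and> M \<le> 1 \<and> popular_corners \<G> \<alpha> M)"

text \<open>The additive group of \<open>\<F>\<^sub>2\<^sup>n\<close>.\<close>

definition F2_power :: "nat \<Rightarrow> (nat \<Rightarrow> int) monoid" where
  "F2_power n = product_group {..<n} (\<lambda>_. integer_mod_group 2)"

lemma popular_corners_0: "popular_corners \<G> \<alpha> 0"
  unfolding popular_corners_def
proof (intro allI impI)
  fix \<epsilon> :: real assume \<epsilon>: "\<epsilon> > 0"
  show "\<exists>N\<^sub>0. \<forall>G\<in>\<G>. order G \<ge> N\<^sub>0 \<longrightarrow>
      (\<forall>A. A \<subseteq> carrier G \<times> carrier G \<and> pair_density G A \<ge> \<alpha> \<longrightarrow>
        (\<exists>d \<in> carrier G - {\<one>\<^bsub>G\<^esub>}.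
           real (card (corner_set G A d)) > (0 - \<epsilon>) * real (order G) ^ 2))"
  proof (intro exI[of _ 2] ballI impI allI)
    fix G A assume N: "2 \<le> order G"
    have "\<not> carrier G \<subseteq> {\<one>\<^bsub>G\<^esub>}"
      using N card_mono[of "{\<one>\<^bsub>G\<^esub>}" "carrier G"] by (auto simp: order_def)
    then obtain d where d: "d \<in> carrier G - {\<one>\<^bsub>G\<^esub>}" by blast
    have "(0 - \<epsilon>) * real (order G) ^ 2 < 0"
      using \<epsilon> N by (simp add: mult_pos_pos)
    also have "0 \<le> real (card (corner_set G A d))" by simp
    finally show "\<exists>d \<in> carrier G - {\<one>\<^bsub>G\<^esub>}.
        real (card (corner_set G A d)) > (0 - \<epsilon>) * real (order G) ^ 2"
      using d by blast
  qed
qed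

lemma threshold_density_greatest:
  shows "0 \<le> threshold_density \<G> \<alpha>" "threshold_density \<G> \<alpha> \<le> 1"
    and "popular_corners \<G> \<alpha> (threshold_density \<G> \<alpha>)"
    and "\<And>M. 0 \<le> M \<Longrightarrow> M \<le> 1 \<Longrightarrow> popular_corners \<G> \<alpha> M \<Longrightarrow> M \<le> threshold_density \<G> \<alpha>"
proof -
  define S where "S = {M. 0 \<le> M \<and> M \<le> 1 \<and> popular_corners \<G> \<alpha> M}"
  have zero: "0 \<in> S"
    using popular_corners_0[of \<G> \<alpha>] by (simp add: S_def)
  then have ne: "S \<noteq> {}" by blast
  have bdd: "bdd_above S" by (auto simp: S_def bdd_above_def)
  have up: "M \<le> Sup S" if "M \<in> S" for M using cSup_upper[OF that bdd] .
  have le1: "Sup S \<le> 1" by (rule cSup_least[OF ne]) (auto simp: S_def)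
  have "popular_corners \<G> \<alpha> (Sup S)"
    unfolding popular_corners_def
  proof (intro allI impI)
    fix \<epsilon> :: real assume \<epsilon>: "\<epsilon> > 0"
    obtain M where M: "M \<in> S" "Sup S - \<epsilon> / 2 < M"
      using less_cSup_iff[OF ne bdd, of "Sup S - \<epsilon> / 2"] \<epsilon> by auto
    then have "popular_corners \<G> \<alpha> M" by (simp add: S_def)
    then obtain N\<^sub>0 where N0: "\<forall>G\<in>\<G>. order G \<ge> N\<^sub>0 \<longrightarrow>
      (\<forall>A. A \<subseteq> carrier G \<times> carrier G \<and> pair_density G A \<ge> \<alpha> \<longrightarrow>
        (\<exists>d \<in> carrier G - {\<one>\<^bsub>G\<^esub>}.
           real (card (corner_set G A d)) > (M - \<epsilon> / 2) * real (order G) ^ 2))"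
      unfolding popular_corners_def using \<epsilon> half_gt_zero by blast
    have mono: "(Sup S - \<epsilon>) * real (order G) ^ 2 \<le> (M - \<epsilon> / 2) * real (order G) ^ 2"
      for G :: "('a, 'b) monoid_scheme"
      using M(2) by (intro mult_right_mono) auto
    show "\<exists>N\<^sub>0. \<forall>G\<in>\<G>. order G \<ge> N\<^sub>0 \<longrightarrow>
      (\<forall>A. A \<subseteq> carrier G \<times> carrier G \<and> pair_density G A \<ge> \<alpha> \<longrightarrow>
        (\<exists>d \<in> carrier G - {\<one>\<^bsub>G\<^esub>}.
           real (card (corner_set G A d)) > (Sup S - \<epsilon>) * real (order G) ^ 2))"
      using N0 mono by (meson order_le_less_trans)
  qed
  with up[OF zero] le1 have "Sup S \<in> S" by (simp add: S_def)
  moreover from this have "threshold_density \<G> \<alpha> = Sup S"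
    unfolding threshold_density_def using up
    by (intro Greatest_equality) (auto simp: S_def)
  ultimately show "0 \<le> threshold_density \<G> \<alpha>" "threshold_density \<G> \<alpha> \<le> 1"
    "popular_corners \<G> \<alpha> (threshold_density \<G> \<alpha>)"
    "\<And>M. 0 \<le> M \<Longrightarrow> M \<le> 1 \<Longrightarrow> popular_corners \<G> \<alpha> M \<Longrightarrow> M \<le> threshold_density \<G> \<alpha>"
    using up by (auto simp: S_def)
qed

lemma comm_group_F2_power: "comm_group (F2_power n)"
proof (rule group.group_comm_groupI)
  show "group (F2_power n)" by (simp add: F2_power_def)
qed (auto simp: F2_power_def add.commute)

lemma order_F2_power: "order (F2_power n) = 2 ^ n"
  by (simp add: F2_power_def order_def carrier_integer_mod_group card_PiE)

lemma finite_F2_power: "finite (carrier (F2_power n))"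
  by (simp add: F2_power_def carrier_integer_mod_group finite_PiE)

end

theory Submission
  imports Defs
begin

text \<open>Let \<open>f\<close> be the indicator function of \<open>A\<close>. In characteristic two a corner of size \<open>d\<close> is a triple
  \<open>(x, y, z)\<close> with \<open>x + y + z = d\<close>, its vertices being \<open>(x, y)\<close>, \<open>(x, x + z)\<close> and \<open>(y + z, y)\<close>. Each vertex
  depends on only two of the three variables, so that corners are the triangles of a tripartite graph
  and \<open>f\<close> may be replaced by simpler functions whenever the error is small in the cut norm. It suffices
  to find a subgroup of bounded index such that the corners whose size lies in it have average density
  almost \<open>\<alpha>\<^sup>4\<close>: the size \<open>0\<close> then has negligible weight as the group grows, so some other size is popular.

  Given a family \<open>\<Phi>\<close> of subsets, let \<open>p 0\<close>, \<open>p 1\<close>, \<open>p 2\<close> be the averages of \<open>f\<close> over the cells on which the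
  \<open>\<Phi>\<close>-atoms of \<open>x\<close> and \<open>y\<close>, of \<open>y\<close> and \<open>x + y\<close>, or of \<open>x\<close> and \<open>x + y\<close> are fixed. Three facts are combined.

  \<^item> Regularity (\<open>strong_regularity\<close>). There are a family \<open>\<Phi>\<close> of bounded size and a
  refinement \<open>\<Phi>'\<close> of \<open>\<Phi>\<close> such that the averages over the two systems of cells are close in \<open>L\<^sup>2\<close>, while
  the difference between \<open>f\<close> and its averages for \<open>\<Phi>'\<close> is as small in the cut norm as any prescribed function
  of the bound on the size of \<open>\<Phi>\<close> demands. Two levels are needed because the subgroup is
  chosen after \<open>\<Phi>\<close>, and the cut norm error is multiplied by its index. Hence \<open>f\<close> may be
  replaced by the averages for \<open>\<Phi>\<close> at each vertex (\<open>triangle_sum_replace\<close>).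

  \<^item> Fourier analysis (\<open>spectral_subgroup\<close>). If all characters at which some atom of \<open>\<Phi>\<close> has a large
  Fourier coefficient are trivial on the subgroup, then triples with \<open>x + y + z\<close> in the subgroup meet the atoms almost as often as
  triples with \<open>x + y + z = 0\<close> do. For the latter triples all three vertices are the same point
  \<open>(x, y)\<close>, and the corner count becomes the mean of \<open>p 0 \<cdot> p 1 \<cdot> p 2\<close>.

  \<^item> A product inequality (\<open>mean_power4_le_mean_cavg_prod\<close>): whatever the cells are, this mean is at
  least \<open>\<alpha>\<^sup>4\<close>.\<close>

section \<open>Conditional averages on a finite set\<close>

definition cavg :: "'w set \<Rightarrow> ('w \<Rightarrow> 'c) \<Rightarrow> ('w \<Rightarrow> real) \<Rightarrow> 'w \<Rightarrow> real" where
  "cavg \<Omega> q f w = (\<Sum>v | v \<in> \<Omega> \<and> q v = q w. f v) / real (card {v \<in> \<Omega>. q v = q w})"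

lemma cavg_cong_label: "q v = q w \<Longrightarrow> cavg \<Omega> q f v = cavg \<Omega> q f w"
  by (simp add: cavg_def)

lemma cavg_nonneg: "(\<And>v. v \<in> \<Omega> \<Longrightarrow> 0 \<le> f v) \<Longrightarrow> 0 \<le> cavg \<Omega> q f w"
  unfolding cavg_def by (intro divide_nonneg_nonneg sum_nonneg) auto

lemma cavg_le_1:
  assumes "\<And>v. v \<in> \<Omega> \<Longrightarrow> f v \<le> 1"
  shows "cavg \<Omega> q f w \<le> 1"
proof -
  have "(\<Sum>v | v \<in> \<Omega> \<and> q v = q w. f v) \<le> (\<Sum>v | v \<in> \<Omega> \<and> q v = q w. 1)"
    using assms by (intro sum_mono) auto
  then show ?thesis unfolding cavg_def by (cases "card {v \<in> \<Omega>. q v = q w} = 0") (simp_all add: divide_le_eq_1)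
qed

text \<open>Averaging over the fibres of \<open>q\<close> is self-adjoint and fixes functions of \<open>q\<close>.\<close>

lemma sum_cavg_mult:
  assumes fin: "finite \<Omega>"
    and k: "\<And>v w. \<lbrakk>v \<in> \<Omega>; w \<in> \<Omega>; q v = q w\<rbrakk> \<Longrightarrow> k v = k w"
  shows "(\<Sum>w\<in>\<Omega>. cavg \<Omega> q f w * k w) = (\<Sum>w\<in>\<Omega>. f w * k w)"
proof -
  define c where "c w = real (card {v \<in> \<Omega>. q v = q w})" for w
  have c_pos: "c w > 0" if "w \<in> \<Omega>" for w
    using that fin by (auto simp: c_def card_gt_0_iff)
  have "(\<Sum>w\<in>\<Omega>. cavg \<Omega> q f w * k w) = (\<Sum>w\<in>\<Omega>. \<Sum>v | v \<in> \<Omega> \<and> q v = q w. f v * k w / c w)"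
    by (simp add: cavg_def c_def sum_divide_distrib sum_distrib_right)
  also have "\<dots> = (\<Sum>v\<in>\<Omega>. \<Sum>w | w \<in> \<Omega> \<and> q v = q w. f v * k w / c w)"
    using fin by (intro sum.swap_restrict) auto
  also have "\<dots> = (\<Sum>v\<in>\<Omega>. f v * k v)"
  proof (rule sum.cong[OF refl])
    fix v assume v: "v \<in> \<Omega>"
    have "(\<Sum>w | w \<in> \<Omega> \<and> q v = q w. f v * k w / c w)
        = (\<Sum>w | w \<in> \<Omega> \<and> q w = q v. f v * k v / c v)"
    proof (rule sum.cong)
      fix w assume "w \<in> {w \<in> \<Omega>. q w = q v}"
      then have w: "w \<in> \<Omega>" "q w = q v" by auto
      then show "f v * k w / c w = f v * k v / c v"
        using k[OF w(1) v w(2)] by (simp add: c_def)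
    qed auto
    also have "\<dots> = f v * k v"
      using c_pos[OF v] by (simp add: c_def)
    finally show "(\<Sum>w | w \<in> \<Omega> \<and> q v = q w. f v * k w / c w) = f v * k v" .
  qed
  finally show ?thesis .
qed

lemma cavg_pythagoras:
  assumes fin: "finite \<Omega>"
    and refines: "\<And>v w. \<lbrakk>v \<in> \<Omega>; w \<in> \<Omega>; q' v = q' w\<rbrakk> \<Longrightarrow> q v = q w"
  shows "(\<Sum>w\<in>\<Omega>. (cavg \<Omega> q' f w - cavg \<Omega> q f w)\<^sup>2)
    = (\<Sum>w\<in>\<Omega>. (cavg \<Omega> q' f w)\<^sup>2) - (\<Sum>w\<in>\<Omega>. (cavg \<Omega> q f w)\<^sup>2)"
proof -
  have "(\<Sum>w\<in>\<Omega>. cavg \<Omega> q' f w * cavg \<Omega> q f w) = (\<Sum>w\<in>\<Omega>. f w * cavg \<Omega> q f w)"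
    by (rule sum_cavg_mult[OF fin]) (metis refines cavg_cong_label)
  moreover have "(\<Sum>w\<in>\<Omega>. cavg \<Omega> q f w * cavg \<Omega> q f w) = (\<Sum>w\<in>\<Omega>. f w * cavg \<Omega> q f w)"
    by (rule sum_cavg_mult[OF fin]) (metis cavg_cong_label)
  moreover have "(\<Sum>w\<in>\<Omega>. (cavg \<Omega> q' f w - cavg \<Omega> q f w)\<^sup>2)
    = (\<Sum>w\<in>\<Omega>. (cavg \<Omega> q' f w)\<^sup>2) - 2 * (\<Sum>w\<in>\<Omega>. cavg \<Omega> q' f w * cavg \<Omega> q f w)
      + (\<Sum>w\<in>\<Omega>. cavg \<Omega> q f w * cavg \<Omega> q f w)"
    by (simp add: power2_eq_square sum.distrib sum_subtractf sum_distrib_left algebra_simps)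
  ultimately show ?thesis by (simp add: power2_eq_square)
qed

lemma sum_abs_le_of_sum_square_le:
  fixes g :: "'w \<Rightarrow> real"
  assumes sq: "(\<Sum>w\<in>\<Omega>. (g w)\<^sup>2) \<le> r\<^sup>2 * real (card \<Omega>)" and r: "0 < r"
  shows "(\<Sum>w\<in>\<Omega>. \<bar>g w\<bar>) \<le> r * real (card \<Omega>)"
proof -
  have "2 * r * \<bar>g w\<bar> \<le> (g w)\<^sup>2 + r\<^sup>2" for w
    using sum_squares_ge_zero[of "\<bar>g w\<bar> - r" 0] by (simp add: power2_eq_square algebra_simps)
  then have "(\<Sum>w\<in>\<Omega>. 2 * r * \<bar>g w\<bar>) \<le> (\<Sum>w\<in>\<Omega>. (g w)\<^sup>2 + r\<^sup>2)" by (intro sum_mono)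
  also have "\<dots> \<le> 2 * r * (r * real (card \<Omega>))"
    using sq by (simp add: sum.distrib power2_eq_square algebra_simps)
  finally show ?thesis using r by (simp add: sum_distrib_left[symmetric])
qed

section \<open>A product inequality for three conditional averages\<close>

lemma arith_geo_mean_inverse3:
  fixes x y z :: real
  assumes "0 < x" "0 < y" "0 < z"
  shows "4 \<le> x * y * z + 1 / x + 1 / y + 1 / z"
proof -
  have two: "2 * sqrt (u * v) \<le> u + v" if "0 \<le> u" "0 \<le> v" for u v :: real
    using arith_geo_mean_sqrt[OF that] by simp
  define u where "u = sqrt (x * y * z * (1 / x))"
  define v where "v = sqrt (1 / y * (1 / z))"
  have "u * v = 1"
    unfolding u_def v_def real_sqrt_mult[symmetric] using assms by simp
  moreover have "0 \<le> u" "0 \<le> v" using assms by (auto simp: u_def v_def)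
  ultimately have "2 \<le> u + v" using two[of u v] by simp
  moreover have "2 * u \<le> x * y * z + 1 / x" "2 * v \<le> 1 / y + 1 / z"
    unfolding u_def v_def by (rule two; use assms in simp)+
  ultimately show ?thesis by linarith
qed

lemma sum_divide_cavg_le:
  assumes fin: "finite \<Omega>" and f: "\<And>w. w \<in> \<Omega> \<Longrightarrow> 0 \<le> f w"
  shows "(\<Sum>w\<in>\<Omega>. f w / cavg \<Omega> q f w) \<le> real (card \<Omega>)"
proof -
  have "(\<Sum>w\<in>\<Omega>. f w * (1 / cavg \<Omega> q f w)) = (\<Sum>w\<in>\<Omega>. cavg \<Omega> q f w * (1 / cavg \<Omega> q f w))"
    by (rule sum_cavg_mult[OF fin, symmetric]) (metis cavg_cong_label)
  also have "\<dots> \<le> (\<Sum>w\<in>\<Omega>. 1)" by (intro sum_mono) simp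
  finally show ?thesis by simp
qed

lemma cavg_pos:
  assumes fin: "finite \<Omega>" and f: "\<And>w. w \<in> \<Omega> \<Longrightarrow> 0 \<le> f w" and w: "w \<in> \<Omega>" "0 < f w"
  shows "0 < cavg \<Omega> q f w"
proof -
  have "0 < (\<Sum>v | v \<in> \<Omega> \<and> q v = q w. f v)"
    by (rule sum_pos2[of _ w]) (use assms in auto)
  moreover have "0 < card {v \<in> \<Omega>. q v = q w}" using fin w by (auto simp: card_gt_0_iff)
  ultimately show ?thesis by (simp add: cavg_def)
qed

text \<open>With \<open>a\<close>, \<open>b\<close>, \<open>c\<close> the three averages, the arithmetic-geometric mean inequality for
  \<open>a b c / \<alpha>\<^sup>3\<close>, \<open>\<alpha> / a\<close>, \<open>\<alpha> / b\<close>, \<open>\<alpha> / c\<close>, whose product is \<open>1\<close>, gives \<open>4 \<le> a b c / \<alpha>\<^sup>3 + \<alpha> / a + \<alpha> / b + \<alpha> / c\<close>.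
  Integrating this against \<open>f\<close> proves the claim, since \<open>f / a\<close> has mean at most \<open>1\<close> and \<open>f \<le> 1\<close>.\<close>

lemma mean_power4_le_mean_cavg_prod:
  fixes f :: "'w \<Rightarrow> real" and \<alpha> :: real
  assumes fin: "finite \<Omega>" and f: "\<And>w. w \<in> \<Omega> \<Longrightarrow> 0 \<le> f w \<and> f w \<le> 1"
    and \<alpha>: "0 \<le> \<alpha>" "\<alpha> * real (card \<Omega>) \<le> (\<Sum>w\<in>\<Omega>. f w)"
  shows "\<alpha> ^ 4 * real (card \<Omega>) \<le> (\<Sum>w\<in>\<Omega>. cavg \<Omega> q f w * cavg \<Omega> q' f w * cavg \<Omega> q'' f w)"
    (is "_ \<le> (\<Sum>w\<in>\<Omega>. ?a w * ?b w * ?c w)")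
proof (cases "\<alpha> = 0")
  case True
  have "0 \<le> (\<Sum>w\<in>\<Omega>. ?a w * ?b w * ?c w)"
    using f by (intro sum_nonneg mult_nonneg_nonneg cavg_nonneg) auto
  then show ?thesis using True by simp
next
  case False
  with \<alpha> have pos: "0 < \<alpha>" by simp
  have f0: "\<And>w. w \<in> \<Omega> \<Longrightarrow> 0 \<le> f w" using f by blast
  have pw: "4 * f w \<le> (?a w * ?b w * ?c w) / \<alpha> ^ 3
      + \<alpha> * (f w / ?a w + f w / ?b w + f w / ?c w)" if w: "w \<in> \<Omega>" for w
  proof (cases "f w = 0")
    case True
    have "0 \<le> ?a w * ?b w * ?c w"
      using f0 by (intro mult_nonneg_nonneg cavg_nonneg) auto
    then show ?thesis using True pos by simp
  next
    case False
    with f0[OF w] have fw: "0 < f w" by simp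
    have abc: "0 < ?a w" "0 < ?b w" "0 < ?c w"
      using cavg_pos[of \<Omega> f, OF fin f0 w fw] by auto
    have "4 \<le> (?a w / \<alpha>) * (?b w / \<alpha>) * (?c w / \<alpha>)
        + 1 / (?a w / \<alpha>) + 1 / (?b w / \<alpha>) + 1 / (?c w / \<alpha>)"
      using abc pos by (intro arith_geo_mean_inverse3) auto
    then have "f w * 4 \<le> f w * ((?a w / \<alpha>) * (?b w / \<alpha>) * (?c w / \<alpha>)
        + 1 / (?a w / \<alpha>) + 1 / (?b w / \<alpha>) + 1 / (?c w / \<alpha>))"
      using fw by (intro mult_left_mono) auto
    also have "\<dots> = f w * ((?a w * ?b w * ?c w) / \<alpha> ^ 3)
        + \<alpha> * (f w / ?a w + f w / ?b w + f w / ?c w)"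
      by (simp add: power3_eq_cube algebra_simps)
    also have "f w * ((?a w * ?b w * ?c w) / \<alpha> ^ 3) \<le> 1 * ((?a w * ?b w * ?c w) / \<alpha> ^ 3)"
      using f[OF w] abc pos by (intro mult_right_mono) auto
    finally show ?thesis by simp
  qed
  let ?T = "\<Sum>w\<in>\<Omega>. ?a w * ?b w * ?c w"
  have "4 * (\<alpha> * real (card \<Omega>)) \<le> 4 * (\<Sum>w\<in>\<Omega>. f w)" using \<alpha> by simp
  also have "\<dots> \<le> (\<Sum>w\<in>\<Omega>. (?a w * ?b w * ?c w) / \<alpha> ^ 3
      + \<alpha> * (f w / ?a w + f w / ?b w + f w / ?c w))"
    unfolding sum_distrib_left by (intro sum_mono pw)
  also have "\<dots> = ?T / \<alpha> ^ 3 + \<alpha> * ((\<Sum>w\<in>\<Omega>. f w / ?a w)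
      + (\<Sum>w\<in>\<Omega>. f w / ?b w) + (\<Sum>w\<in>\<Omega>. f w / ?c w))"
    by (simp add: sum.distrib sum_distrib_left sum_divide_distrib distrib_left)
  also have "\<dots> \<le> ?T / \<alpha> ^ 3 + \<alpha> * (real (card \<Omega>) + real (card \<Omega>) + real (card \<Omega>))"
    using sum_divide_cavg_le[of \<Omega> f q, OF fin f0] sum_divide_cavg_le[of \<Omega> f q', OF fin f0]
      sum_divide_cavg_le[of \<Omega> f q'', OF fin f0] pos
    by (intro add_left_mono mult_left_mono add_mono) auto
  finally have "\<alpha> * real (card \<Omega>) \<le> ?T / \<alpha> ^ 3" by (simp add: algebra_simps)
  then have "\<alpha> * real (card \<Omega>) * \<alpha> ^ 3 \<le> ?T"
    using pos by (simp add: pos_le_divide_eq)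
  then show ?thesis by (simp add: power4_eq_xxxx power3_eq_cube mult_ac)
qed

section \<open>Regularity for the cut norm\<close>

text \<open>A partition of the ground set is encoded by a finite family \<open>\<Phi>\<close> of subsets, its cells being
  the atoms of the algebra that \<open>\<Phi>\<close> generates. Refinement is then inclusion of families, and \<open>\<Phi>\<close> has
  at most \<open>2 ^ card \<Phi>\<close> atoms.\<close>

definition atom_of :: "'g set set \<Rightarrow> 'g \<Rightarrow> 'g set set" where
  "atom_of \<Phi> x = {B \<in> \<Phi>. x \<in> B}"

definition pair_label :: "('w \<Rightarrow> 'g) \<Rightarrow> ('w \<Rightarrow> 'g) \<Rightarrow> 'g set set \<Rightarrow> 'w \<Rightarrow> 'g set set \<times> 'g set set" where
  "pair_label s t \<Phi> w = (atom_of \<Phi> (s w), atom_of \<Phi> (t w))"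

definition energy ::
  "'w set \<Rightarrow> ('w \<Rightarrow> real) \<Rightarrow> ('i \<Rightarrow> 'w \<Rightarrow> 'g) \<Rightarrow> ('i \<Rightarrow> 'w \<Rightarrow> 'g) \<Rightarrow> 'i set \<Rightarrow> 'g set set \<Rightarrow> real" where
  "energy \<Omega> f s t I \<Phi> = (\<Sum>i\<in>I. \<Sum>w\<in>\<Omega>. (cavg \<Omega> (pair_label (s i) (t i) \<Phi>) f w)\<^sup>2)"

text \<open>A one-sided bound suffices, since \<open>a\<close> may be replaced by \<open>- a\<close>.\<close>

definition cut_uniform ::
  "'w set \<Rightarrow> ('w \<Rightarrow> real) \<Rightarrow> ('i \<Rightarrow> 'w \<Rightarrow> 'g) \<Rightarrow> ('i \<Rightarrow> 'w \<Rightarrow> 'g) \<Rightarrow> 'i set \<Rightarrow> real \<Rightarrow> 'g set set \<Rightarrow> bool"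
  where
  "cut_uniform \<Omega> f s t I \<eta> \<Phi> \<longleftrightarrow>
    (\<forall>i\<in>I. \<forall>a b. (\<forall>w\<in>\<Omega>. \<bar>a (s i w)\<bar> \<le> 1 \<and> \<bar>b (t i w)\<bar> \<le> 1) \<longrightarrow>
      (\<Sum>w\<in>\<Omega>. (f w - cavg \<Omega> (pair_label (s i) (t i) \<Phi>) f w) * a (s i w) * b (t i w))
        \<le> \<eta> * real (card \<Omega>))"

definition sign_of :: "'g set \<Rightarrow> 'g \<Rightarrow> real" where
  "sign_of A x = (if x \<in> A then 1 else - 1)"

lemma pair_label_refines:
  assumes "\<Phi> \<subseteq> \<Phi>'" and "pair_label s t \<Phi>' v = pair_label s t \<Phi>' w"
  shows "pair_label s t \<Phi> v = pair_label s t \<Phi> w"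
  using assms unfolding pair_label_def atom_of_def by blast

lemma sign_of_cong_atom: "\<lbrakk>A \<in> \<Phi>; atom_of \<Phi> x = atom_of \<Phi> y\<rbrakk> \<Longrightarrow> sign_of A x = sign_of A y"
  unfolding atom_of_def sign_of_def by (smt (verit) mem_Collect_eq)

text \<open>The sum is linear in \<open>a\<close>, so its maximum over \<open>[-1, 1]\<close>-valued \<open>a\<close> is attained at a sign function.
  This turns a witness against uniformity into two sets, by which the partition can be refined.\<close>

lemma round_to_sign:
  assumes fin: "finite \<Omega>" and a: "\<And>w. w \<in> \<Omega> \<Longrightarrow> \<bar>a (s w)\<bar> \<le> 1"
  obtains A where "(\<Sum>w\<in>\<Omega>. g w * a (s w)) \<le> (\<Sum>w\<in>\<Omega>. g w * sign_of A (s w))"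
proof
  define h where "h x = (\<Sum>w | w \<in> \<Omega> \<and> s w = x. g w)" for x
  let ?A = "{x. 0 \<le> h x}"
  have group: "(\<Sum>w\<in>\<Omega>. g w * c (s w)) = (\<Sum>x\<in>s ` \<Omega>. h x * c x)" for c :: "'b \<Rightarrow> real"
    by (subst sum.image_gen[OF fin, of _ s]) (simp add: h_def sum_distrib_right)
  have "h x * a x \<le> h x * sign_of ?A x" if "x \<in> s ` \<Omega>" for x
  proof -
    have "\<bar>a x\<bar> \<le> 1" using that a by auto
    then have "\<bar>h x\<bar> * \<bar>a x\<bar> \<le> \<bar>h x\<bar>" by (simp add: mult_left_le)
    then have "h x * a x \<le> \<bar>h x\<bar>" by (simp add: abs_mult[symmetric])
    then show ?thesis by (auto simp: sign_of_def)
  qed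
  then show "(\<Sum>w\<in>\<Omega>. g w * a (s w)) \<le> (\<Sum>w\<in>\<Omega>. g w * sign_of ?A (s w))"
    unfolding group by (rule sum_mono)
qed

lemma energy_diff:
  assumes "finite \<Omega>" "\<Phi> \<subseteq> \<Phi>'"
  shows "energy \<Omega> f s t I \<Phi>' - energy \<Omega> f s t I \<Phi> =
    (\<Sum>i\<in>I. \<Sum>w\<in>\<Omega>. (cavg \<Omega> (pair_label (s i) (t i) \<Phi>') f w
                  - cavg \<Omega> (pair_label (s i) (t i) \<Phi>) f w)\<^sup>2)"
  unfolding energy_def sum_subtractf[symmetric]
  by (intro sum.cong[OF refl] cavg_pythagoras[symmetric, unfolded sum_subtractf[symmetric]])
    (use assms pair_label_refines in auto)

lemma cavg_diff_le_energy_diff: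
  assumes "finite \<Omega>" "\<Phi> \<subseteq> \<Phi>'" "finite I" "i \<in> I"
  shows "(\<Sum>w\<in>\<Omega>. (cavg \<Omega> (pair_label (s i) (t i) \<Phi>') f w
                  - cavg \<Omega> (pair_label (s i) (t i) \<Phi>) f w)\<^sup>2)
    \<le> energy \<Omega> f s t I \<Phi>' - energy \<Omega> f s t I \<Phi>"
  unfolding energy_diff[OF assms(1,2)]
  by (rule member_le_sum[OF assms(4)]) (use assms in \<open>auto intro: sum_nonneg\<close>)

lemma energy_nonneg: "0 \<le> energy \<Omega> f s t I \<Phi>"
  unfolding energy_def by (intro sum_nonneg) auto

lemma energy_le:
  assumes "\<And>w. w \<in> \<Omega> \<Longrightarrow> 0 \<le> f w \<and> f w \<le> 1"
  shows "energy \<Omega> f s t I \<Phi> \<le> real (card I) * real (card \<Omega>)"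
proof -
  have "energy \<Omega> f s t I \<Phi> \<le> (\<Sum>i\<in>I. \<Sum>w\<in>\<Omega>. 1)"
    unfolding energy_def using assms
    by (intro sum_mono power_le_one cavg_nonneg cavg_le_1) auto
  then show ?thesis by simp
qed

text \<open>After refinement by the sets that witness non-uniformity, the witness is constant on cells, so
  the new average of \<open>f\<close> has the same correlation with it as \<open>f\<close> itself. The two averages therefore
  differ by at least \<open>\<eta>\<close> in \<open>L\<^sup>1\<close>, hence in \<open>L\<^sup>2\<close>, and the Pythagorean identity applies.\<close>

lemma energy_increment:
  assumes fin: "finite \<Omega>" "finite I" and \<eta>: "0 < \<eta>"
    and not_uniform: "\<not> cut_uniform \<Omega> f s t I \<eta> \<Phi>"
  obtains A B where
    "energy \<Omega> f s t I \<Phi> + \<eta>\<^sup>2 * real (card \<Omega>) \<le> energy \<Omega> f s t I (\<Phi> \<union> {A, B})"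
proof -
  from not_uniform obtain i a b where i: "i \<in> I"
    and ab: "\<And>w. w \<in> \<Omega> \<Longrightarrow> \<bar>a (s i w)\<bar> \<le> 1" "\<And>w. w \<in> \<Omega> \<Longrightarrow> \<bar>b (t i w)\<bar> \<le> 1"
    and big: "\<eta> * real (card \<Omega>) <
      (\<Sum>w\<in>\<Omega>. (f w - cavg \<Omega> (pair_label (s i) (t i) \<Phi>) f w) * a (s i w) * b (t i w))"
    unfolding cut_uniform_def by (auto simp: not_le)
  define g where "g w = f w - cavg \<Omega> (pair_label (s i) (t i) \<Phi>) f w" for w
  obtain B where B: "(\<Sum>w\<in>\<Omega>. (g w * a (s i w)) * b (t i w))
      \<le> (\<Sum>w\<in>\<Omega>. (g w * a (s i w)) * sign_of B (t i w))"
    by (rule round_to_sign[where a = b and s = "t i" and g = "\<lambda>w. g w * a (s i w)", OF fin(1) ab(2)])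
  obtain A where A: "(\<Sum>w\<in>\<Omega>. (g w * sign_of B (t i w)) * a (s i w))
      \<le> (\<Sum>w\<in>\<Omega>. (g w * sign_of B (t i w)) * sign_of A (s i w))"
    by (rule round_to_sign[where a = a and s = "s i" and g = "\<lambda>w. g w * sign_of B (t i w)",
          OF fin(1) ab(1)])
  define k where "k w = sign_of B (t i w) * sign_of A (s i w)" for w
  let ?\<Phi>' = "\<Phi> \<union> {A, B}"
  let ?c = "cavg \<Omega> (pair_label (s i) (t i) \<Phi>) f"
  let ?c' = "cavg \<Omega> (pair_label (s i) (t i) ?\<Phi>') f"
  have k_label: "k v = k w" if "pair_label (s i) (t i) ?\<Phi>' v = pair_label (s i) (t i) ?\<Phi>' w" for v w
    using that sign_of_cong_atom[of A ?\<Phi>' "s i v" "s i w"] sign_of_cong_atom[of B ?\<Phi>' "t i v" "t i w"]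
    by (simp add: k_def pair_label_def)
  have "\<eta> * real (card \<Omega>) < (\<Sum>w\<in>\<Omega>. g w * k w)"
    using big A B by (simp add: g_def k_def mult_ac)
  also have "\<dots> = (\<Sum>w\<in>\<Omega>. f w * k w) - (\<Sum>w\<in>\<Omega>. ?c w * k w)"
    by (simp add: g_def left_diff_distrib sum_subtractf)
  also have "(\<Sum>w\<in>\<Omega>. f w * k w) = (\<Sum>w\<in>\<Omega>. ?c' w * k w)"
    by (rule sum_cavg_mult[OF fin(1), symmetric]) (rule k_label)
  also have "\<dots> - (\<Sum>w\<in>\<Omega>. ?c w * k w) = (\<Sum>w\<in>\<Omega>. (?c' w - ?c w) * k w)"
    by (simp add: left_diff_distrib sum_subtractf)
  also have "\<dots> \<le> (\<Sum>w\<in>\<Omega>. \<bar>?c' w - ?c w\<bar>)"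
    by (intro sum_mono) (auto simp: k_def sign_of_def)
  finally have "\<eta>\<^sup>2 * real (card \<Omega>) \<le> (\<Sum>w\<in>\<Omega>. (?c' w - ?c w)\<^sup>2)"
    using sum_abs_le_of_sum_square_le[OF _ \<eta>, of "\<lambda>w. ?c' w - ?c w" \<Omega>] by linarith
  also have "\<dots> \<le> energy \<Omega> f s t I ?\<Phi>' - energy \<Omega> f s t I \<Phi>"
    by (rule cavg_diff_le_energy_diff) (use fin i in auto)
  finally show thesis by (intro that[of A B]) simp
qed

lemma weak_regularity:
  assumes fin: "finite \<Omega>" "\<Omega> \<noteq> {}" "finite I" "finite \<Phi>" and \<eta>: "0 < \<eta>"
    and f: "\<And>w. w \<in> \<Omega> \<Longrightarrow> 0 \<le> f w \<and> f w \<le> 1"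
    and j: "real (card I) < real j * \<eta>\<^sup>2"
  obtains \<Phi>' where "\<Phi> \<subseteq> \<Phi>'" "finite \<Phi>'" "card \<Phi>' \<le> card \<Phi> + 2 * j"
    "cut_uniform \<Omega> f s t I \<eta> \<Phi>'"
proof -
  have "\<exists>\<Phi>'. \<Phi> \<subseteq> \<Phi>' \<and> finite \<Phi>' \<and> card \<Phi>' \<le> card \<Phi> + 2 * j \<and>
      (cut_uniform \<Omega> f s t I \<eta> \<Phi>' \<or> real j * \<eta>\<^sup>2 * real (card \<Omega>) \<le> energy \<Omega> f s t I \<Phi>')" for j
  proof (induction j)
    case 0
    show ?case using fin energy_nonneg[of \<Omega> f s t I \<Phi>] by (intro exI[of _ \<Phi>]) auto
  next
    case (Suc j)
    then obtain \<Phi>' where \<Phi>': "\<Phi> \<subseteq> \<Phi>'" "finite \<Phi>'" "card \<Phi>' \<le> card \<Phi> + 2 * j"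
      "cut_uniform \<Omega> f s t I \<eta> \<Phi>' \<or> real j * \<eta>\<^sup>2 * real (card \<Omega>) \<le> energy \<Omega> f s t I \<Phi>'" by blast
    show ?case
    proof (cases "cut_uniform \<Omega> f s t I \<eta> \<Phi>'")
      case True
      then show ?thesis using \<Phi>' by (intro exI[of _ \<Phi>']) auto
    next
      case False
      obtain A B where AB:
        "energy \<Omega> f s t I \<Phi>' + \<eta>\<^sup>2 * real (card \<Omega>) \<le> energy \<Omega> f s t I (\<Phi>' \<union> {A, B})"
        using energy_increment[OF fin(1,3) \<eta> False] .
      have "card (\<Phi>' \<union> {A, B}) \<le> card \<Phi>' + card {A, B}" by (rule card_Un_le)
      also have "card {A, B} \<le> 2" by (simp add: card_insert_if)
      finally have "card (\<Phi>' \<union> {A, B}) \<le> card \<Phi> + 2 * Suc j" using \<Phi>'(3) by simp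
      moreover have "real (Suc j) * \<eta>\<^sup>2 * real (card \<Omega>) \<le> energy \<Omega> f s t I (\<Phi>' \<union> {A, B})"
        using AB \<Phi>'(4) False by (simp add: algebra_simps)
      ultimately show ?thesis using \<Phi>'(1,2) by (intro exI[of _ "\<Phi>' \<union> {A, B}"]) auto
    qed
  qed
  then obtain \<Phi>' where \<Phi>': "\<Phi> \<subseteq> \<Phi>'" "finite \<Phi>'" "card \<Phi>' \<le> card \<Phi> + 2 * j"
    "cut_uniform \<Omega> f s t I \<eta> \<Phi>' \<or> real j * \<eta>\<^sup>2 * real (card \<Omega>) \<le> energy \<Omega> f s t I \<Phi>'" by blast
  have "real (card I) * real (card \<Omega>) < real j * \<eta>\<^sup>2 * real (card \<Omega>)"
    using j fin by (simp add: card_gt_0_iff)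
  then have "\<not> real j * \<eta>\<^sup>2 * real (card \<Omega>) \<le> energy \<Omega> f s t I \<Phi>'"
    using energy_le[of \<Omega> f s t I \<Phi>'] f by fastforce
  with \<Phi>' that show thesis by blast
qed

text \<open>The sizes of the successive families in the proof of \<open>strong_regularity\<close>, where \<open>m\<close> is the
  number of coordinate pairs. They are explicit because the size of the group has to be bounded below
  before the group and the set \<open>A\<close> are given.\<close>

definition regularity_step :: "nat \<Rightarrow> (nat \<Rightarrow> real) \<Rightarrow> nat \<Rightarrow> nat" where
  "regularity_step m \<eta> l = l + 2 * (nat \<lfloor>real m / (\<eta> l)\<^sup>2\<rfloor> + 1)"

definition regularity_bound :: "nat \<Rightarrow> (nat \<Rightarrow> real) \<Rightarrow> nat \<Rightarrow> nat" where
  "regularity_bound m \<eta> k = (regularity_step m \<eta> ^^ k) 0"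

text \<open>Iterate \<open>weak_regularity\<close> with uniformity parameters that depend on the current size. The
  energy is at most \<open>card I\<close>, so one of the first \<open>K\<close> refinements increases it by at most \<open>\<tau>\<close>.\<close>

lemma strong_regularity:
  assumes fin: "finite \<Omega>" "\<Omega> \<noteq> {}" "finite I" and \<eta>: "\<And>l. 0 < \<eta> l"
    and f: "\<And>w. w \<in> \<Omega> \<Longrightarrow> 0 \<le> f w \<and> f w \<le> 1"
    and K: "real (card I) < real K * \<tau>"
  obtains k \<Phi> \<Phi>' where "k < K" "finite \<Phi>" "card \<Phi> \<le> regularity_bound (card I) \<eta> k" "\<Phi> \<subseteq> \<Phi>'"
    "energy \<Omega> f s t I \<Phi>' - energy \<Omega> f s t I \<Phi> \<le> \<tau> * real (card \<Omega>)"
    "cut_uniform \<Omega> f s t I (\<eta> (regularity_bound (card I) \<eta> k)) \<Phi>'"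
proof -
  let ?l = "regularity_bound (card I) \<eta>"
  let ?E = "energy \<Omega> f s t I"
  define good where "good k \<longleftrightarrow> (\<exists>\<Phi> \<Phi>'. finite \<Phi> \<and> card \<Phi> \<le> ?l k \<and> \<Phi> \<subseteq> \<Phi>' \<and>
    ?E \<Phi>' - ?E \<Phi> \<le> \<tau> * real (card \<Omega>) \<and> cut_uniform \<Omega> f s t I (\<eta> (?l k)) \<Phi>')" for k
  have "\<exists>k<K. good k"
  proof (rule ccontr)
    assume none: "\<not> (\<exists>k<K. good k)"
    have "k \<le> K \<Longrightarrow> \<exists>\<Phi>. finite \<Phi> \<and> card \<Phi> \<le> ?l k \<and> real k * \<tau> * real (card \<Omega>) \<le> ?E \<Phi>" for k
    proof (induction k)
      case 0
      show ?case by (rule exI[of _ "{}"]) (simp add: energy_nonneg)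
    next
      case (Suc k)
      then obtain \<Phi> where \<Phi>: "finite \<Phi>" "card \<Phi> \<le> ?l k" "real k * \<tau> * real (card \<Omega>) \<le> ?E \<Phi>"
        by auto
      define j where "j = nat \<lfloor>real (card I) / (\<eta> (?l k))\<^sup>2\<rfloor> + 1"
      have "real (card I) / (\<eta> (?l k))\<^sup>2 < real j" unfolding j_def by linarith
      then have j: "real (card I) < real j * (\<eta> (?l k))\<^sup>2"
        using \<eta>[of "?l k"] by (simp add: pos_divide_less_eq)
      obtain \<Phi>' where \<Phi>': "\<Phi> \<subseteq> \<Phi>'" "finite \<Phi>'" "card \<Phi>' \<le> card \<Phi> + 2 * j"
        "cut_uniform \<Omega> f s t I (\<eta> (?l k)) \<Phi>'"
        by (rule weak_regularity[where s = s and t = t, OF fin \<Phi>(1) \<eta> f j])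
      have "\<not> good k" using none Suc.prems by auto
      then have "\<tau> * real (card \<Omega>) < ?E \<Phi>' - ?E \<Phi>"
        using \<Phi> \<Phi>' unfolding good_def by (meson not_le)
      then have "real (Suc k) * \<tau> * real (card \<Omega>) \<le> ?E \<Phi>'"
        using \<Phi>(3) by (simp add: algebra_simps)
      moreover have "card \<Phi>' \<le> ?l (Suc k)"
        using \<Phi>(2) \<Phi>'(3) by (simp add: regularity_bound_def regularity_step_def j_def)
      ultimately show ?case using \<Phi>'(2) by blast
    qed
    then obtain \<Phi> where "real K * \<tau> * real (card \<Omega>) \<le> ?E \<Phi>" by blast
    moreover have "real (card I) * real (card \<Omega>) < real K * \<tau> * real (card \<Omega>)"
      using K fin by (simp add: card_gt_0_iff)
    ultimately show False using energy_le[of \<Omega> f s t I \<Phi>] f by fastforce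
  qed
  then show thesis unfolding good_def using that by blast
qed

section \<open>Fourier analysis on a self-dual elementary abelian 2-group\<close>

text \<open>The number of frequencies needed for a family of \<open>l\<close> sets: such a family has at most \<open>2 ^ l\<close>
  atoms, hence \<open>8 ^ l\<close> triples of atoms, each of which may contribute an error \<open>\<rho> / 8 ^ l\<close>. An atom has
  at most \<open>1 / \<delta>\<^sup>2\<close> Fourier coefficients larger than \<open>\<delta> = \<rho> / 8 ^ l\<close>, and a set of \<open>s\<close> frequencies generates a
  group of at most \<open>2 ^ s\<close> elements.\<close>

definition dual_bound :: "real \<Rightarrow> nat \<Rightarrow> nat" where
  "dual_bound \<rho> l = 2 ^ nat \<lfloor>2 ^ l / (\<rho> / 8 ^ l)\<^sup>2\<rfloor>"

text \<open>Bounds for the size of the family when the cut norm error, multiplied by the number of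
  frequencies, is to be at most \<open>\<rho>\<close>.\<close>

definition atoms_bound :: "real \<Rightarrow> nat \<Rightarrow> nat" where
  "atoms_bound \<rho> = regularity_bound 3 (\<lambda>l. \<rho> / real (dual_bound \<rho> l))"

text \<open>The pairing \<open>e\<close> identifies the group with its dual, so that frequencies are group elements too.\<close>

locale self_dual_two_group = comm_group G for G (structure) +
  fixes e :: "'a \<Rightarrow> 'a \<Rightarrow> real"
  assumes finite_carrier: "finite (carrier G)"
    and square: "x \<in> carrier G \<Longrightarrow> x \<otimes> x = \<one>"
    and e_sign: "\<lbrakk>r \<in> carrier G; x \<in> carrier G\<rbrakk> \<Longrightarrow> e r x = 1 \<or> e r x = - 1"
    and e_commute: "e r x = e x r"
    and e_mult: "\<lbrakk>r \<in> carrier G; x \<in> carrier G; y \<in> carrier G\<rbrakk> \<Longrightarrow> e r (x \<otimes> y) = e r x * e r y"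
    and e_nondegenerate: "\<lbrakk>r \<in> carrier G; r \<noteq> \<one>\<rbrakk> \<Longrightarrow> \<exists>x\<in>carrier G. e r x \<noteq> 1"
begin

abbreviation U where "U \<equiv> carrier G"
abbreviation N where "N \<equiv> real (order G)"

lemma N_pos: "0 < N"
  using finite_carrier by (auto simp: order_def card_gt_0_iff)

lemma cancel: "\<lbrakk>x \<in> U; y \<in> U\<rbrakk> \<Longrightarrow> x \<otimes> (x \<otimes> y) = y"
  using m_assoc[of x x y] square[of x] by simp

lemma cancel_comm: "\<lbrakk>x \<in> U; y \<in> U\<rbrakk> \<Longrightarrow> x \<otimes> (y \<otimes> x) = y"
  using cancel[of x y] by (simp add: m_comm)

lemma sum_translate: "y \<in> U \<Longrightarrow> (\<Sum>x\<in>U. F (y \<otimes> x)) = (\<Sum>x\<in>U. F x)"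
  by (rule sum.reindex_bij_witness[of _ "\<lambda>x. y \<otimes> x" "\<lambda>x. y \<otimes> x"]) (auto simp: cancel)

lemma e_one: "r \<in> U \<Longrightarrow> e r \<one> = 1"
  using e_mult[of r \<one> \<one>] e_sign[of r \<one>] by auto

lemma e_mult_left: "\<lbrakk>r \<in> U; s \<in> U; x \<in> U\<rbrakk> \<Longrightarrow> e (r \<otimes> s) x = e r x * e s x"
  using e_mult[of x r s] by (simp add: e_commute[of _ x])

lemma abs_e: "\<lbrakk>r \<in> U; x \<in> U\<rbrakk> \<Longrightarrow> \<bar>e r x\<bar> = 1"
  using e_sign[of r x] by auto

text \<open>For a subgroup \<open>\<Gamma>\<close> of frequencies this is the indicator function of the annihilator of \<open>\<Gamma>\<close>, scaled to
  have mean \<open>1\<close>. It is defined for arbitrary sets in order to be additive in \<open>\<Gamma>\<close>.\<close>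

definition char_sum :: "'a set \<Rightarrow> 'a \<Rightarrow> real" where
  "char_sum \<Gamma> d = (\<Sum>r\<in>\<Gamma>. e r d)"

lemma char_sum_subgroup:
  assumes \<Gamma>: "subgroup \<Gamma> G" and d: "d \<in> U"
  shows "char_sum \<Gamma> d = (if \<forall>r\<in>\<Gamma>. e r d = 1 then real (card \<Gamma>) else 0)"
proof (cases "\<forall>r\<in>\<Gamma>. e r d = 1")
  case False
  then obtain r where r: "r \<in> \<Gamma>" "e r d \<noteq> 1" by blast
  have sub: "\<Gamma> \<subseteq> U" using \<Gamma> by (rule subgroup.subset)
  with r have er: "e r d = - 1" using e_sign[of r d] d by auto
  have "char_sum \<Gamma> d = (\<Sum>s\<in>\<Gamma>. e (r \<otimes> s) d)"
    unfolding char_sum_def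
    by (rule sum.reindex_bij_witness[of _ "\<lambda>s. r \<otimes> s" "\<lambda>s. r \<otimes> s"])
      (use r sub \<Gamma> in \<open>auto simp: cancel subsetD intro: subgroup.m_closed\<close>)
  also have "\<dots> = (\<Sum>s\<in>\<Gamma>. - e s d)"
    by (intro sum.cong refl) (use r(1) sub d er in \<open>auto simp: e_mult_left subsetD\<close>)
  also have "\<dots> = - char_sum \<Gamma> d" by (simp add: char_sum_def sum_negf)
  finally show ?thesis using False by auto
qed (simp add: char_sum_def)

lemma char_sum_nonneg: "\<lbrakk>subgroup \<Gamma> G; d \<in> U\<rbrakk> \<Longrightarrow> 0 \<le> char_sum \<Gamma> d"
  by (simp add: char_sum_subgroup)

lemma char_sum_carrier: "d \<in> U \<Longrightarrow> char_sum U d = (if d = \<one> then N else 0)"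
  using e_nondegenerate[of d]
  by (auto simp: char_sum_subgroup[OF subgroup_self] order_def e_commute[of _ d] e_one e_commute[of \<one>])

lemma sum_char_sum:
  assumes "\<Gamma> \<subseteq> U" "\<one> \<in> \<Gamma>"
  shows "(\<Sum>d\<in>U. char_sum \<Gamma> d) = N"
proof -
  have fin: "finite \<Gamma>" using assms(1) finite_carrier finite_subset by blast
  have "(\<Sum>d\<in>U. char_sum \<Gamma> d) = (\<Sum>r\<in>\<Gamma>. \<Sum>d\<in>U. e r d)"
    unfolding char_sum_def by (rule sum.swap)
  also have "\<dots> = (\<Sum>r\<in>\<Gamma>. char_sum U r)"
    by (intro sum.cong refl) (simp add: char_sum_def e_commute)
  also have "\<dots> = (\<Sum>r\<in>\<Gamma>. if r = \<one> then N else 0)"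
    by (intro sum.cong refl char_sum_carrier) (use assms in auto)
  finally show ?thesis using assms fin by simp
qed

definition fourier :: "('a \<Rightarrow> real) \<Rightarrow> 'a \<Rightarrow> real" where
  "fourier A r = (\<Sum>x\<in>U. A x * e r x)"

lemma parseval: "(\<Sum>r\<in>U. (fourier A r)\<^sup>2) = N * (\<Sum>x\<in>U. (A x)\<^sup>2)"
proof -
  have "(\<Sum>r\<in>U. (fourier A r)\<^sup>2) = (\<Sum>r\<in>U. \<Sum>x\<in>U. \<Sum>y\<in>U. A x * A y * e r (x \<otimes> y))"
    unfolding fourier_def power2_eq_square sum_product
    by (intro sum.cong refl) (simp add: e_mult)
  also have "\<dots> = (\<Sum>x\<in>U. \<Sum>y\<in>U. \<Sum>r\<in>U. A x * A y * e r (x \<otimes> y))"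
    by (subst sum.swap) (intro sum.cong refl sum.swap)
  also have "\<dots> = (\<Sum>x\<in>U. \<Sum>y\<in>U. if y = x then N * (A x)\<^sup>2 else 0)"
  proof (intro sum.cong refl)
    fix x y assume xy: "x \<in> U" "y \<in> U"
    have "x \<otimes> y = \<one> \<longleftrightarrow> y = x" using xy cancel[of x y] square[of x] by auto
    then show "(\<Sum>r\<in>U. A x * A y * e r (x \<otimes> y)) = (if y = x then N * (A x)\<^sup>2 else 0)"
      using char_sum_carrier[of "x \<otimes> y"] xy
      by (auto simp: char_sum_def sum_distrib_left[symmetric] power2_eq_square)
  qed
  also have "\<dots> = N * (\<Sum>x\<in>U. (A x)\<^sup>2)"
    using finite_carrier by (simp add: sum_distrib_left)
  finally show ?thesis .
qed

lemma parseval_le: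
  assumes "\<And>x. x \<in> U \<Longrightarrow> \<bar>A x\<bar> \<le> 1"
  shows "(\<Sum>r\<in>U. (fourier A r)\<^sup>2) \<le> N\<^sup>2"
proof -
  have "(\<Sum>x\<in>U. (A x)\<^sup>2) \<le> (\<Sum>x\<in>U. 1)"
    using assms by (intro sum_mono) (simp add: abs_square_le_1)
  then show ?thesis unfolding parseval
    by (simp add: power2_eq_square order_def mult_left_mono)
qed

lemma card_large_spectrum:
  assumes A: "\<And>x. x \<in> U \<Longrightarrow> \<bar>A x\<bar> \<le> 1" and \<delta>: "0 < \<delta>"
  shows "real (card {r \<in> U. \<delta> * N < \<bar>fourier A r\<bar>}) \<le> 1 / \<delta>\<^sup>2" (is "real (card ?S) \<le> _")
proof -
  have "real (card ?S) * (\<delta> * N)\<^sup>2 = (\<Sum>r\<in>?S. (\<delta> * N)\<^sup>2)" by simp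
  also have "\<dots> \<le> (\<Sum>r\<in>?S. (fourier A r)\<^sup>2)"
  proof (rule sum_mono)
    fix r assume "r \<in> ?S"
    then have "(\<delta> * N)\<^sup>2 \<le> \<bar>fourier A r\<bar>\<^sup>2" using \<delta> N_pos by (intro power_mono) auto
    then show "(\<delta> * N)\<^sup>2 \<le> (fourier A r)\<^sup>2" by simp
  qed
  also have "\<dots> \<le> (\<Sum>r\<in>U. (fourier A r)\<^sup>2)"
    using finite_carrier by (intro sum_mono2) auto
  also have "\<dots> \<le> N\<^sup>2" by (rule parseval_le[OF A])
  finally have "(real (card ?S) * \<delta>\<^sup>2) * N\<^sup>2 \<le> 1 * N\<^sup>2" by (simp add: power_mult_distrib mult_ac)
  then have "real (card ?S) * \<delta>\<^sup>2 \<le> 1"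
    using N_pos by (subst (asm) mult_le_cancel_right_pos) simp_all
  then show ?thesis using \<delta> by (simp add: pos_le_divide_eq)
qed

lemma subgroup_containing:
  assumes "finite S" "S \<subseteq> U"
  obtains \<Gamma> where "subgroup \<Gamma> G" "S \<subseteq> \<Gamma>" "card \<Gamma> \<le> 2 ^ card S"
proof -
  have "\<exists>\<Gamma>. subgroup \<Gamma> G \<and> S \<subseteq> \<Gamma> \<and> card \<Gamma> \<le> 2 ^ card S"
    using assms
  proof (induction S)
    case empty
    show ?case by (rule exI[of _ "{\<one>}"]) (simp add: triv_subgroup)
  next
    case (insert s S)
    then obtain \<Gamma> where \<Gamma>: "subgroup \<Gamma> G" "S \<subseteq> \<Gamma>" "card \<Gamma> \<le> 2 ^ card S" by auto
    have s: "s \<in> U" using insert by auto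
    have sub: "\<Gamma> \<subseteq> U" using \<Gamma>(1) by (rule subgroup.subset)
    let ?\<Delta> = "\<Gamma> \<union> (\<lambda>r. s \<otimes> r) ` \<Gamma>"
    have one: "\<one> \<in> \<Gamma>" using \<Gamma>(1) by (rule subgroup.one_closed)
    have closed: "\<And>x y. \<lbrakk>x \<in> \<Gamma>; y \<in> \<Gamma>\<rbrakk> \<Longrightarrow> x \<otimes> y \<in> \<Gamma>" using \<Gamma>(1) by (rule subgroup.m_closed)
    have inv_self: "inv x = x" if "x \<in> U" for x using that square[OF that] by (simp add: inv_equality)
    have "subgroup ?\<Delta> G"
    proof (rule subgroupI)
      show "?\<Delta> \<subseteq> U" using sub s by auto
      show "?\<Delta> \<noteq> {}" using one by auto
      show "inv a \<in> ?\<Delta>" if "a \<in> ?\<Delta>" for a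
        using that inv_self[of a] \<open>?\<Delta> \<subseteq> U\<close> by auto
      show "a \<otimes> b \<in> ?\<Delta>" if a: "a \<in> ?\<Delta>" and b: "b \<in> ?\<Delta>" for a b
      proof -
        obtain x where x: "x \<in> \<Gamma>" "a = x \<or> a = s \<otimes> x" using a by auto
        obtain y where y: "y \<in> \<Gamma>" "b = y \<or> b = s \<otimes> y" using b by auto
        have U: "x \<in> U" "y \<in> U" using x y sub by auto
        have xy: "x \<otimes> y \<in> \<Gamma>" using x y closed by blast
        have "a \<otimes> b = x \<otimes> y \<or> a \<otimes> b = s \<otimes> (x \<otimes> y)"
          using x(2) y(2) U s by (auto simp: m_ac cancel)
        then show ?thesis using xy by auto
      qed
    qed
    moreover have "insert s S \<subseteq> ?\<Delta>" using \<Gamma>(2) one s by (auto intro!: image_eqI[of _ _ \<one>])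
    moreover have "card ?\<Delta> \<le> 2 ^ card (insert s S)"
    proof -
      have "finite \<Gamma>" using sub finite_carrier finite_subset by blast
      then have "card ?\<Delta> \<le> card \<Gamma> + card \<Gamma>"
        using card_Un_le[of \<Gamma> "(\<lambda>r. s \<otimes> r) ` \<Gamma>"] card_image_le[of \<Gamma> "\<lambda>r. s \<otimes> r"] by linarith
      then show ?thesis using \<Gamma>(3) insert by simp
    qed
    ultimately show ?case by blast
  qed
  then show thesis using that by blast
qed

section \<open>Weighted triangle sums\<close>

text \<open>For a subgroup \<open>\<Gamma>\<close>, \<open>triangle_sum \<Gamma> F / N\<^sup>3\<close> is the average of \<open>F\<close> over the triples whose sum annihilates
  \<open>\<Gamma>\<close>.\<close>

definition triangle_sum :: "'a set \<Rightarrow> ('a \<Rightarrow> 'a \<Rightarrow> 'a \<Rightarrow> real) \<Rightarrow> real" where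
  "triangle_sum \<Gamma> F = (\<Sum>x\<in>U. \<Sum>y\<in>U. \<Sum>z\<in>U. char_sum \<Gamma> (x \<otimes> y \<otimes> z) * F x y z)"

lemma triangle_sum_cong:
  "(\<And>x y z. \<lbrakk>x \<in> U; y \<in> U; z \<in> U\<rbrakk> \<Longrightarrow> F x y z = F' x y z) \<Longrightarrow> triangle_sum \<Gamma> F = triangle_sum \<Gamma> F'"
  unfolding triangle_sum_def by (intro sum.cong refl) auto

lemma triangle_sum_sum:
  "triangle_sum \<Gamma> (\<lambda>x y z. \<Sum>i\<in>I. F i x y z) = (\<Sum>i\<in>I. triangle_sum \<Gamma> (F i))"
proof -
  have "triangle_sum \<Gamma> (\<lambda>x y z. \<Sum>i\<in>I. F i x y z)
      = (\<Sum>x\<in>U. \<Sum>y\<in>U. \<Sum>z\<in>U. \<Sum>i\<in>I. char_sum \<Gamma> (x \<otimes> y \<otimes> z) * F i x y z)"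
    by (simp add: triangle_sum_def sum_distrib_left)
  also have "\<dots> = (\<Sum>x\<in>U. \<Sum>y\<in>U. \<Sum>i\<in>I. \<Sum>z\<in>U. char_sum \<Gamma> (x \<otimes> y \<otimes> z) * F i x y z)"
    by (intro sum.cong refl sum.swap)
  also have "\<dots> = (\<Sum>x\<in>U. \<Sum>i\<in>I. \<Sum>y\<in>U. \<Sum>z\<in>U. char_sum \<Gamma> (x \<otimes> y \<otimes> z) * F i x y z)"
    by (intro sum.cong refl sum.swap)
  also have "\<dots> = (\<Sum>i\<in>I. triangle_sum \<Gamma> (F i))"
    unfolding triangle_sum_def by (rule sum.swap)
  finally show ?thesis .
qed

lemma triangle_sum_cmult: "triangle_sum \<Gamma> (\<lambda>x y z. c * F x y z) = c * triangle_sum \<Gamma> F"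
  by (simp add: triangle_sum_def sum_distrib_left mult.left_commute)

lemma triangle_sum_add:
  "triangle_sum \<Gamma> (\<lambda>x y z. F x y z + F' x y z) = triangle_sum \<Gamma> F + triangle_sum \<Gamma> F'"
  by (simp add: triangle_sum_def distrib_left sum.distrib)

lemma triangle_sum_rotate:
  "triangle_sum \<Gamma> (\<lambda>x y z. F y z x) = triangle_sum \<Gamma> F"
proof -
  have "triangle_sum \<Gamma> (\<lambda>x y z. F y z x)
      = (\<Sum>y\<in>U. \<Sum>z\<in>U. \<Sum>x\<in>U. char_sum \<Gamma> (x \<otimes> y \<otimes> z) * F y z x)"
    unfolding triangle_sum_def by (subst sum.swap) (intro sum.cong refl sum.swap)
  also have "\<dots> = triangle_sum \<Gamma> F"
    unfolding triangle_sum_def by (intro sum.cong refl) (simp add: m_ac)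
  finally show ?thesis .
qed

lemma triangle_sum_swap:
  "triangle_sum \<Gamma> (\<lambda>x y z. F x z y) = triangle_sum \<Gamma> F"
proof -
  have "triangle_sum \<Gamma> (\<lambda>x y z. F x z y)
      = (\<Sum>x\<in>U. \<Sum>z\<in>U. \<Sum>y\<in>U. char_sum \<Gamma> (x \<otimes> y \<otimes> z) * F x z y)"
    unfolding triangle_sum_def by (intro sum.cong refl sum.swap)
  also have "\<dots> = triangle_sum \<Gamma> F"
    unfolding triangle_sum_def by (intro sum.cong refl) (simp add: m_ac)
  finally show ?thesis .
qed

lemma triangle_sum_frequencies:
  assumes "\<Gamma> \<subseteq> U"
  shows "triangle_sum \<Gamma> F
    = (\<Sum>r\<in>\<Gamma>. \<Sum>z\<in>U. \<Sum>x\<in>U. \<Sum>y\<in>U. e r x * e r y * e r z * F x y z)"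
proof -
  have "triangle_sum \<Gamma> F = (\<Sum>x\<in>U. \<Sum>y\<in>U. \<Sum>z\<in>U. \<Sum>r\<in>\<Gamma>. e r x * e r y * e r z * F x y z)"
    unfolding triangle_sum_def char_sum_def sum_distrib_right
    by (intro sum.cong refl) (use assms in \<open>auto simp: e_mult subsetD\<close>)
  also have "\<dots> = (\<Sum>x\<in>U. \<Sum>y\<in>U. \<Sum>r\<in>\<Gamma>. \<Sum>z\<in>U. e r x * e r y * e r z * F x y z)"
    by (intro sum.cong refl sum.swap)
  also have "\<dots> = (\<Sum>x\<in>U. \<Sum>r\<in>\<Gamma>. \<Sum>y\<in>U. \<Sum>z\<in>U. e r x * e r y * e r z * F x y z)"
    by (intro sum.cong refl sum.swap)
  also have "\<dots> = (\<Sum>r\<in>\<Gamma>. \<Sum>x\<in>U. \<Sum>y\<in>U. \<Sum>z\<in>U. e r x * e r y * e r z * F x y z)"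
    by (rule sum.swap)
  also have "\<dots> = (\<Sum>r\<in>\<Gamma>. \<Sum>x\<in>U. \<Sum>z\<in>U. \<Sum>y\<in>U. e r x * e r y * e r z * F x y z)"
    by (intro sum.cong refl sum.swap)
  also have "\<dots> = (\<Sum>r\<in>\<Gamma>. \<Sum>z\<in>U. \<Sum>x\<in>U. \<Sum>y\<in>U. e r x * e r y * e r z * F x y z)"
    by (intro sum.cong refl sum.swap)
  finally show ?thesis .
qed

lemma triangle_sum_product:
  assumes "\<Gamma> \<subseteq> U"
  shows "triangle_sum \<Gamma> (\<lambda>x y z. A x * B y * C z) = (\<Sum>r\<in>\<Gamma>. fourier A r * fourier B r * fourier C r)"
  unfolding triangle_sum_frequencies[OF assms]
proof (rule sum.cong[OF refl])
  fix r assume "r \<in> \<Gamma>"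
  have "(\<Sum>z\<in>U. \<Sum>x\<in>U. \<Sum>y\<in>U. e r x * e r y * e r z * (A x * B y * C z))
      = (\<Sum>z\<in>U. \<Sum>x\<in>U. \<Sum>y\<in>U. (A x * e r x) * (B y * e r y) * (C z * e r z))"
    by (intro sum.cong refl) (simp add: mult_ac)
  also have "\<dots> = fourier A r * fourier B r * fourier C r"
    by (simp add: fourier_def flip: sum_distrib_left sum_distrib_right)
  finally show "(\<Sum>z\<in>U. \<Sum>x\<in>U. \<Sum>y\<in>U. e r x * e r y * e r z * (A x * B y * C z))
      = fourier A r * fourier B r * fourier C r" .
qed

lemma triangle_sum_carrier: "triangle_sum U F = N * (\<Sum>x\<in>U. \<Sum>y\<in>U. F x y (x \<otimes> y))"
proof -
  have "triangle_sum U F = (\<Sum>x\<in>U. \<Sum>y\<in>U. \<Sum>z\<in>U. if z = x \<otimes> y then N * F x y (x \<otimes> y) else 0)"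
    unfolding triangle_sum_def
  proof (intro sum.cong refl)
    fix x y z assume xyz: "x \<in> U" "y \<in> U" "z \<in> U"
    have "x \<otimes> y \<otimes> z = \<one> \<longleftrightarrow> z = x \<otimes> y"
      using xyz cancel[of "x \<otimes> y" z] square[of "x \<otimes> y"] by auto
    then show "char_sum U (x \<otimes> y \<otimes> z) * F x y z = (if z = x \<otimes> y then N * F x y (x \<otimes> y) else 0)"
      using char_sum_carrier[of "x \<otimes> y \<otimes> z"] xyz by auto
  qed
  also have "\<dots> = (\<Sum>x\<in>U. \<Sum>y\<in>U. N * F x y (x \<otimes> y))"
    by (intro sum.cong refl) (use finite_carrier in simp)
  finally show ?thesis by (simp add: sum_distrib_left)
qed

lemma triangle_sum_complement:
  assumes "\<Gamma> \<subseteq> U"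
  shows "triangle_sum \<Gamma> F = triangle_sum U F - triangle_sum (U - \<Gamma>) F"
proof -
  have "char_sum \<Gamma> d = char_sum U d - char_sum (U - \<Gamma>) d" for d
    unfolding char_sum_def using sum.subset_diff[OF assms finite_carrier, of "\<lambda>r. e r d"] by simp
  then show ?thesis by (simp add: triangle_sum_def left_diff_distrib sum_subtractf)
qed

text \<open>For small \<open>fourier A\<close>, Cauchy's inequality and Parseval's identity for \<open>B\<close> and \<open>C\<close> bound the sum
  over the frequencies.\<close>

lemma triangle_sum_product_small:
  assumes bnd: "\<And>x. x \<in> U \<Longrightarrow> \<bar>B x\<bar> \<le> 1" "\<And>x. x \<in> U \<Longrightarrow> \<bar>C x\<bar> \<le> 1"
    and \<Gamma>: "\<Gamma> \<subseteq> U" and small: "\<And>r. r \<in> \<Gamma> \<Longrightarrow> \<bar>fourier A r\<bar> \<le> \<delta> * N" and \<delta>: "0 \<le> \<delta>"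
  shows "\<bar>triangle_sum \<Gamma> (\<lambda>x y z. A x * B y * C z)\<bar> \<le> \<delta> * N ^ 3"
proof -
  have "\<bar>triangle_sum \<Gamma> (\<lambda>x y z. A x * B y * C z)\<bar>
      \<le> (\<Sum>r\<in>\<Gamma>. \<bar>fourier A r * fourier B r * fourier C r\<bar>)"
    unfolding triangle_sum_product[OF \<Gamma>] by (rule sum_abs)
  also have "\<dots> \<le> (\<Sum>r\<in>\<Gamma>. \<delta> * N * (((fourier B r)\<^sup>2 + (fourier C r)\<^sup>2) / 2))"
  proof (rule sum_mono)
    fix r assume r: "r \<in> \<Gamma>"
    have "2 * (\<bar>fourier B r\<bar> * \<bar>fourier C r\<bar>) \<le> (fourier B r)\<^sup>2 + (fourier C r)\<^sup>2"
      using sum_squares_ge_zero[of "\<bar>fourier B r\<bar> - \<bar>fourier C r\<bar>" 0]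
      by (simp add: power2_eq_square algebra_simps)
    then have "\<bar>fourier A r\<bar> * (\<bar>fourier B r\<bar> * \<bar>fourier C r\<bar>)
        \<le> \<delta> * N * (((fourier B r)\<^sup>2 + (fourier C r)\<^sup>2) / 2)"
      using small[OF r] \<delta> N_pos by (intro mult_mono) auto
    then show "\<bar>fourier A r * fourier B r * fourier C r\<bar>
        \<le> \<delta> * N * (((fourier B r)\<^sup>2 + (fourier C r)\<^sup>2) / 2)"
      by (simp add: abs_mult mult.assoc)
  qed
  also have "\<dots> \<le> (\<Sum>r\<in>U. \<delta> * N * (((fourier B r)\<^sup>2 + (fourier C r)\<^sup>2) / 2))"
    using \<Gamma> \<delta> N_pos finite_carrier by (intro sum_mono2) auto
  also have "\<dots> = \<delta> * N * (((\<Sum>r\<in>U. (fourier B r)\<^sup>2) + (\<Sum>r\<in>U. (fourier C r)\<^sup>2)) / 2)"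
    by (simp add: sum_distrib_left sum.distrib add_divide_distrib sum_divide_distrib distrib_left)
  also have "\<dots> \<le> \<delta> * N * ((N\<^sup>2 + N\<^sup>2) / 2)"
    using \<delta> N_pos by (intro mult_left_mono divide_right_mono add_mono parseval_le bnd) auto
  also have "\<dots> = \<delta> * N ^ 3" by (simp add: power2_eq_square power3_eq_cube)
  finally show ?thesis .
qed

text \<open>Used with \<open>\<Gamma>\<close> the set of frequencies outside a spectral subgroup: the error is then that of
  replacing all frequencies by this subgroup.\<close>

lemma triangle_sum_labels_small:
  assumes L: "finite L" "\<And>x. x \<in> U \<Longrightarrow> lab x \<in> L"
    and F: "\<And>x y z. \<lbrakk>x \<in> U; y \<in> U; z \<in> U\<rbrakk> \<Longrightarrow> F x y z = W (lab x) (lab y) (lab z)"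
    and W: "\<And>a b c. \<bar>W a b c\<bar> \<le> 1"
    and \<Gamma>: "\<Gamma> \<subseteq> U" and \<delta>: "0 \<le> \<delta>"
    and small: "\<And>a r. \<lbrakk>a \<in> L; r \<in> \<Gamma>\<rbrakk> \<Longrightarrow> \<bar>fourier (\<lambda>x. of_bool (lab x = a)) r\<bar> \<le> \<delta> * N"
  shows "\<bar>triangle_sum \<Gamma> F\<bar> \<le> real (card L) ^ 3 * (\<delta> * N ^ 3)"
proof -
  define ind :: "_ \<Rightarrow> 'a \<Rightarrow> real" where "ind a x = of_bool (lab x = a)" for a x
  have ind_bound: "\<bar>ind a x\<bar> \<le> 1" for a x by (simp add: ind_def)
  have "triangle_sum \<Gamma> F
      = triangle_sum \<Gamma> (\<lambda>x y z. \<Sum>a\<in>L. \<Sum>b\<in>L. \<Sum>c\<in>L. W a b c * (ind a x * ind b y * ind c z))"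
  proof (rule triangle_sum_cong)
    fix x y z assume xyz: "x \<in> U" "y \<in> U" "z \<in> U"
    have "(\<Sum>a\<in>L. \<Sum>b\<in>L. \<Sum>c\<in>L. W a b c * (ind a x * ind b y * ind c z))
        = (\<Sum>a\<in>L. if a = lab x then \<Sum>b\<in>L. if b = lab y then
             \<Sum>c\<in>L. if c = lab z then W a b c else 0 else 0 else 0)"
      by (intro sum.cong refl) (auto simp: ind_def intro!: sum.cong sum.neutral)
    also have "\<dots> = F x y z" using L xyz by (simp add: F)
    finally show "F x y z
        = (\<Sum>a\<in>L. \<Sum>b\<in>L. \<Sum>c\<in>L. W a b c * (ind a x * ind b y * ind c z))" by simp
  qed
  also have "\<dots> = (\<Sum>a\<in>L. \<Sum>b\<in>L. \<Sum>c\<in>L.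
      W a b c * triangle_sum \<Gamma> (\<lambda>x y z. ind a x * ind b y * ind c z))"
    by (simp add: triangle_sum_sum triangle_sum_cmult)
  also have "\<bar>\<dots>\<bar> \<le> (\<Sum>a\<in>L. \<Sum>b\<in>L. \<Sum>c\<in>L.
      \<bar>W a b c * triangle_sum \<Gamma> (\<lambda>x y z. ind a x * ind b y * ind c z)\<bar>)"
    by (intro order_trans[OF sum_abs] sum_mono order_refl)
  also have "\<dots> \<le> (\<Sum>a\<in>L. \<Sum>b\<in>L. \<Sum>c\<in>L. 1 * (\<delta> * N ^ 3))"
    unfolding abs_mult
  proof (intro sum_mono mult_mono W)
    fix a b c assume "a \<in> L" "b \<in> L" "c \<in> L"
    show "\<bar>triangle_sum \<Gamma> (\<lambda>x y z. ind a x * ind b y * ind c z)\<bar> \<le> \<delta> * N ^ 3"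
      by (rule triangle_sum_product_small[OF ind_bound ind_bound \<Gamma> _ \<delta>])
        (use small \<open>a \<in> L\<close> in \<open>simp add: ind_def\<close>)
  qed auto
  also have "\<dots> = real (card L) ^ 3 * (\<delta> * N ^ 3)" by (simp add: power3_eq_cube)
  finally show ?thesis .
qed

text \<open>For a fixed frequency and fixed \<open>z\<close>, the characters split into factors depending on \<open>x\<close>, \<open>y\<close>
  and \<open>z\<close> separately, so the sum over \<open>x\<close> and \<open>y\<close> is of the form that the cut norm controls. This loses
  a factor \<open>card \<Gamma>\<close>.\<close>

lemma triangle_sum_cut_lower:
  assumes \<Gamma>: "\<Gamma> \<subseteq> U"
    and cut: "\<And>a b. (\<forall>x\<in>U. \<bar>a x\<bar> \<le> 1 \<and> \<bar>b x\<bar> \<le> 1) \<Longrightarrow> (\<Sum>x\<in>U. \<Sum>y\<in>U. h x y * a x * b y) \<le> \<eta> * N\<^sup>2"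
    and u: "\<And>x z. \<lbrakk>x \<in> U; z \<in> U\<rbrakk> \<Longrightarrow> \<bar>u x z\<bar> \<le> 1" and v: "\<And>y z. \<lbrakk>y \<in> U; z \<in> U\<rbrakk> \<Longrightarrow> \<bar>v y z\<bar> \<le> 1"
  shows "- (real (card \<Gamma>) * \<eta> * N ^ 3) \<le> triangle_sum \<Gamma> (\<lambda>x y z. h x y * (u x z * v y z))"
proof -
  have "(\<Sum>r\<in>\<Gamma>. \<Sum>z\<in>U. \<Sum>x\<in>U. \<Sum>y\<in>U. - (e r x * e r y * e r z * (h x y * (u x z * v y z))))
      \<le> (\<Sum>r\<in>\<Gamma>. \<Sum>z\<in>U. \<eta> * N\<^sup>2)"
  proof (intro sum_mono)
    fix r z assume rz: "r \<in> \<Gamma>" "z \<in> U"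
    then have r: "r \<in> U" using \<Gamma> by blast
    have "(\<Sum>x\<in>U. \<Sum>y\<in>U. - (e r x * e r y * e r z * (h x y * (u x z * v y z))))
        = (\<Sum>x\<in>U. \<Sum>y\<in>U. h x y * (- (e r z * e r x * u x z)) * (e r y * v y z))"
      by (intro sum.cong refl) (simp add: mult_ac)
    also have "\<dots> \<le> \<eta> * N\<^sup>2"
      by (rule cut) (use r rz u v in \<open>simp add: abs_mult abs_e\<close>)
    finally show "(\<Sum>x\<in>U. \<Sum>y\<in>U. - (e r x * e r y * e r z * (h x y * (u x z * v y z)))) \<le> \<eta> * N\<^sup>2" .
  qed
  then show ?thesis
    unfolding triangle_sum_frequencies[OF \<Gamma>]
    by (simp add: sum_negf order_def power2_eq_square power3_eq_cube mult_ac)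
qed

text \<open>In the weighted measure on triples with weights \<open>char_sum \<Gamma> (x \<otimes> y \<otimes> z)\<close>, the pair \<open>(x, y)\<close> is
  uniformly distributed. Hence an \<open>L\<^sup>1\<close> error is not multiplied by \<open>card \<Gamma>\<close>.\<close>

lemma triangle_sum_abs_le:
  assumes \<Gamma>: "subgroup \<Gamma> G"
    and u: "\<And>x z. \<lbrakk>x \<in> U; z \<in> U\<rbrakk> \<Longrightarrow> \<bar>u x z\<bar> \<le> 1" and v: "\<And>y z. \<lbrakk>y \<in> U; z \<in> U\<rbrakk> \<Longrightarrow> \<bar>v y z\<bar> \<le> 1"
  shows "\<bar>triangle_sum \<Gamma> (\<lambda>x y z. h x y * (u x z * v y z))\<bar> \<le> N * (\<Sum>x\<in>U. \<Sum>y\<in>U. \<bar>h x y\<bar>)"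
proof -
  have "\<bar>triangle_sum \<Gamma> (\<lambda>x y z. h x y * (u x z * v y z))\<bar>
      \<le> (\<Sum>x\<in>U. \<Sum>y\<in>U. \<Sum>z\<in>U. \<bar>char_sum \<Gamma> (x \<otimes> y \<otimes> z) * (h x y * (u x z * v y z))\<bar>)"
    unfolding triangle_sum_def by (intro order_trans[OF sum_abs] sum_mono order_refl)
  also have "\<dots> \<le> (\<Sum>x\<in>U. \<Sum>y\<in>U. \<Sum>z\<in>U. char_sum \<Gamma> (x \<otimes> y \<otimes> z) * (\<bar>h x y\<bar> * (1 * 1)))"
    unfolding abs_mult
    by (intro sum_mono mult_mono u v) (auto simp: char_sum_nonneg[OF \<Gamma>])
  also have "\<dots> = (\<Sum>x\<in>U. \<Sum>y\<in>U. N * \<bar>h x y\<bar>)"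
  proof (intro sum.cong refl)
    fix x y assume "x \<in> U" "y \<in> U"
    then have "(\<Sum>z\<in>U. char_sum \<Gamma> (x \<otimes> y \<otimes> z)) = N"
      using sum_translate[of "x \<otimes> y" "char_sum \<Gamma>"]
        sum_char_sum[OF subgroup.subset[OF \<Gamma>] subgroup.one_closed[OF \<Gamma>]] by simp
    then show "(\<Sum>z\<in>U. char_sum \<Gamma> (x \<otimes> y \<otimes> z) * (\<bar>h x y\<bar> * (1 * 1))) = N * \<bar>h x y\<bar>"
      by (simp flip: sum_distrib_right)
  qed
  finally show ?thesis by (simp add: sum_distrib_left)
qed

text \<open>The function \<open>k'\<close> lies between \<open>g\<close> and \<open>k\<close>: close to \<open>g\<close> in the cut norm and to \<open>k\<close> in \<open>L\<^sup>1\<close>.\<close>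

lemma triangle_sum_replace:
  assumes \<Gamma>: "subgroup \<Gamma> G" and \<eta>: "real (card \<Gamma>) * \<eta> \<le> \<rho>"
    and cut: "\<And>a b. (\<forall>x\<in>U. \<bar>a x\<bar> \<le> 1 \<and> \<bar>b x\<bar> \<le> 1) \<Longrightarrow>
      (\<Sum>x\<in>U. \<Sum>y\<in>U. (g x y - k' x y) * a x * b y) \<le> \<eta> * N\<^sup>2"
    and L1: "(\<Sum>x\<in>U. \<Sum>y\<in>U. \<bar>k' x y - k x y\<bar>) \<le> \<rho> * N\<^sup>2"
    and u: "\<And>x z. \<lbrakk>x \<in> U; z \<in> U\<rbrakk> \<Longrightarrow> \<bar>u x z\<bar> \<le> 1" and v: "\<And>y z. \<lbrakk>y \<in> U; z \<in> U\<rbrakk> \<Longrightarrow> \<bar>v y z\<bar> \<le> 1"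
  shows "triangle_sum \<Gamma> (\<lambda>x y z. k x y * (u x z * v y z)) - 2 * \<rho> * N ^ 3
    \<le> triangle_sum \<Gamma> (\<lambda>x y z. g x y * (u x z * v y z))"
proof -
  have "triangle_sum \<Gamma> (\<lambda>x y z. g x y * (u x z * v y z))
      = triangle_sum \<Gamma> (\<lambda>x y z. (g x y - k' x y) * (u x z * v y z))
      + triangle_sum \<Gamma> (\<lambda>x y z. (k' x y - k x y) * (u x z * v y z))
      + triangle_sum \<Gamma> (\<lambda>x y z. k x y * (u x z * v y z))"
    unfolding triangle_sum_add[symmetric] by (rule triangle_sum_cong) (simp add: algebra_simps)
  moreover have "- (\<rho> * N ^ 3) \<le> triangle_sum \<Gamma> (\<lambda>x y z. (g x y - k' x y) * (u x z * v y z))"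
  proof -
    have "real (card \<Gamma>) * \<eta> * N ^ 3 \<le> \<rho> * N ^ 3"
      using \<eta> N_pos by (intro mult_right_mono) auto
    moreover have "- (real (card \<Gamma>) * \<eta> * N ^ 3)
        \<le> triangle_sum \<Gamma> (\<lambda>x y z. (g x y - k' x y) * (u x z * v y z))"
      by (rule triangle_sum_cut_lower[OF subgroup.subset[OF \<Gamma>]]) (use cut u v in auto)
    ultimately show ?thesis by linarith
  qed
  moreover have "- (\<rho> * N ^ 3) \<le> triangle_sum \<Gamma> (\<lambda>x y z. (k' x y - k x y) * (u x z * v y z))"
  proof -
    have "N * (\<Sum>x\<in>U. \<Sum>y\<in>U. \<bar>k' x y - k x y\<bar>) \<le> N * (\<rho> * N\<^sup>2)"
      using L1 N_pos by (intro mult_left_mono) auto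
    also have "\<dots> = \<rho> * N ^ 3" by (simp add: power2_eq_square power3_eq_cube)
    finally show ?thesis
      using triangle_sum_abs_le[where u = u and v = v and h = "\<lambda>x y. k' x y - k x y", OF \<Gamma> u v]
      by linarith
  qed
  ultimately show ?thesis by linarith
qed

section \<open>Corners as triangles\<close>

text \<open>The three pairs of variables on which the vertices of a triangle depend, for \<open>z = x \<otimes> y\<close>: the pair
  \<open>(x, y)\<close> for \<open>i = 0\<close>, \<open>(y, z)\<close> for \<open>i = 1\<close> and \<open>(x, z)\<close> for \<open>i = 2\<close>. Each is a system of coordinates on
  the plane.\<close>

definition first_coord :: "nat \<Rightarrow> 'a \<times> 'a \<Rightarrow> 'a" where
  "first_coord i w = (if i = 1 then snd w else fst w)"

definition second_coord :: "nat \<Rightarrow> 'a \<times> 'a \<Rightarrow> 'a" where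
  "second_coord i w = (if i = 0 then snd w else fst w \<otimes> snd w)"

definition point :: "nat \<Rightarrow> 'a \<Rightarrow> 'a \<Rightarrow> 'a \<times> 'a" where
  "point i p q = (if i = 0 then (p, q) else if i = 1 then (p \<otimes> q, p) else (p, p \<otimes> q))"

lemma point_in: "\<lbrakk>p \<in> U; q \<in> U\<rbrakk> \<Longrightarrow> point i p q \<in> U \<times> U"
  by (simp add: point_def)

lemma coord_point:
  assumes "p \<in> U" "q \<in> U"
  shows "first_coord i (point i p q) = p" "second_coord i (point i p q) = q"
  using assms by (auto simp: point_def first_coord_def second_coord_def cancel m_comm[of "p \<otimes> q" p])

lemma point_coord:
  assumes "w \<in> U \<times> U"
  shows "point i (first_coord i w) (second_coord i w) = w"
    and "first_coord i w \<in> U" "second_coord i w \<in> U"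
  using assms by (auto simp: point_def first_coord_def second_coord_def cancel cancel_comm m_comm[of _ "fst w"])

lemma sum_point:
  "(\<Sum>p\<in>U. \<Sum>q\<in>U. H (point i p q) p q) = (\<Sum>w\<in>U \<times> U. H w (first_coord i w) (second_coord i w))"
  unfolding sum.cartesian_product
  by (rule sum.reindex_bij_witness[of _ "\<lambda>w. (first_coord i w, second_coord i w)" "\<lambda>(p, q). point i p q"])
    (auto simp: point_in coord_point point_coord split: prod.splits)

text \<open>Take the group generated by the large spectra of all atoms. The frequencies outside it have
  small coefficients at every atom, so passing from all frequencies to this group, which replaces the
  condition \<open>x \<otimes> y \<otimes> z = \<one>\<close> by a weaker one, changes the sum of a function of the atoms only slightly.\<close>

lemma spectral_subgroup:
  assumes \<Phi>: "finite \<Phi>" "card \<Phi> \<le> l" and \<rho>: "0 < \<rho>"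
  obtains \<Gamma> where "subgroup \<Gamma> G" "card \<Gamma> \<le> dual_bound \<rho> l"
    "\<And>F W. \<lbrakk>\<And>x y z. \<lbrakk>x \<in> U; y \<in> U; z \<in> U\<rbrakk> \<Longrightarrow>
            F x y z = W (atom_of \<Phi> x) (atom_of \<Phi> y) (atom_of \<Phi> z);
          \<And>a b c. \<bar>W a b c\<bar> \<le> 1\<rbrakk> \<Longrightarrow>
        triangle_sum U F - \<rho> * N ^ 3 \<le> triangle_sum \<Gamma> F"
proof -
  define \<delta> where "\<delta> = \<rho> / 8 ^ l"
  have \<delta>: "0 < \<delta>" using \<rho> by (simp add: \<delta>_def)
  let ?ind = "\<lambda>a x. of_bool (atom_of \<Phi> x = a) :: real"
  let ?spec = "\<lambda>a. {r \<in> U. \<delta> * N < \<bar>fourier (?ind a) r\<bar>}"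
  define S where "S = (\<Union>a\<in>Pow \<Phi>. ?spec a)"
  have cardL: "real (card (Pow \<Phi>)) \<le> 2 ^ l" using \<Phi> by (simp add: card_Pow)
  have S: "finite S" "S \<subseteq> U" unfolding S_def using \<Phi> finite_carrier by auto
  have "real (card S) \<le> (\<Sum>a\<in>Pow \<Phi>. real (card (?spec a)))"
    unfolding S_def of_nat_sum[symmetric] of_nat_le_iff by (rule card_UN_le) (use \<Phi> in simp)
  also have "\<dots> \<le> (\<Sum>a\<in>Pow \<Phi>. 1 / \<delta>\<^sup>2)"
    by (intro sum_mono card_large_spectrum \<delta>) auto
  also have "\<dots> = real (card (Pow \<Phi>)) / \<delta>\<^sup>2" by simp
  also have "\<dots> \<le> 2 ^ l / \<delta>\<^sup>2" using cardL by (intro divide_right_mono) auto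
  finally have "card S \<le> nat \<lfloor>2 ^ l / \<delta>\<^sup>2\<rfloor>" by (simp add: le_nat_floor)
  obtain \<Gamma> where \<Gamma>: "subgroup \<Gamma> G" "S \<subseteq> \<Gamma>" "card \<Gamma> \<le> 2 ^ card S"
    using subgroup_containing[OF S] .
  have "card \<Gamma> \<le> dual_bound \<rho> l"
    unfolding dual_bound_def \<delta>_def[symmetric]
    by (rule order_trans[OF \<Gamma>(3)]) (use \<open>card S \<le> _\<close> in \<open>simp add: power_increasing\<close>)
  then show thesis
  proof (rule that[OF \<Gamma>(1)])
    fix F :: "'a \<Rightarrow> 'a \<Rightarrow> 'a \<Rightarrow> real" and W
    assume F: "\<And>x y z. \<lbrakk>x \<in> U; y \<in> U; z \<in> U\<rbrakk> \<Longrightarrow>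
        F x y z = W (atom_of \<Phi> x) (atom_of \<Phi> y) (atom_of \<Phi> z)"
      and W: "\<And>a b c. \<bar>W a b c\<bar> \<le> 1"
    have "\<bar>triangle_sum (U - \<Gamma>) F\<bar> \<le> real (card (Pow \<Phi>)) ^ 3 * (\<delta> * N ^ 3)"
    proof (rule triangle_sum_labels_small[where lab = "atom_of \<Phi>" and W = W])
      show "\<bar>fourier (?ind a) r\<bar> \<le> \<delta> * N" if "a \<in> Pow \<Phi>" "r \<in> U - \<Gamma>" for a r
      proof (rule ccontr)
        assume "\<not> ?thesis"
        then have "r \<in> ?spec a" using that by simp
        then have "r \<in> S" using that(1) unfolding S_def by blast
        then show False using that \<Gamma>(2) by auto
      qed
    qed (use \<Phi> \<delta> F W in \<open>auto simp: atom_of_def\<close>)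
    also have "\<dots> \<le> (2 ^ l) ^ 3 * (\<delta> * N ^ 3)"
      using cardL \<delta> N_pos by (intro mult_right_mono power_mono) auto
    also have "(2 ^ l) ^ 3 = (8 :: real) ^ l" 
      by (simp add: power_mult[symmetric] mult.commute[of l] power_mult[of 2 3])
    also have "8 ^ l * (\<delta> * N ^ 3) = \<rho> * N ^ 3" by (simp add: \<delta>_def)
    finally show "triangle_sum U F - \<rho> * N ^ 3 \<le> triangle_sum \<Gamma> F"
      using triangle_sum_complement[OF subgroup.subset[OF \<Gamma>(1)], of F] by linarith
  qed
qed

text \<open>The loss \<open>7 \<rho>\<close> consists of \<open>2 \<rho>\<close> for each of the three vertices, at which \<open>f\<close> is replaced by an average,
  and \<open>\<rho>\<close> for the passage to \<open>x \<otimes> y \<otimes> z = \<one>\<close>.\<close>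

lemma weighted_corners_lower:
  fixes f :: "'a \<Rightarrow> 'a \<Rightarrow> real" and \<alpha> \<rho> :: real
  assumes f: "\<And>x y. \<lbrakk>x \<in> U; y \<in> U\<rbrakk> \<Longrightarrow> 0 \<le> f x y \<and> f x y \<le> 1"
    and \<alpha>: "0 \<le> \<alpha>" "\<alpha> * N\<^sup>2 \<le> (\<Sum>x\<in>U. \<Sum>y\<in>U. f x y)"
    and \<rho>: "0 < \<rho>" and K: "3 < real K * \<rho>\<^sup>2"
  obtains k \<Gamma> where "k < K" "subgroup \<Gamma> G" "card \<Gamma> \<le> dual_bound \<rho> (atoms_bound \<rho> k)"
    "(\<alpha> ^ 4 - 7 * \<rho>) * N ^ 3
      \<le> triangle_sum \<Gamma> (\<lambda>x y z. f x y * (f x (x \<otimes> z) * f (y \<otimes> z) y))"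
proof -
  define \<Omega> where "\<Omega> = U \<times> U"
  define F where "F = (\<lambda>(x, y). f x y)"
  define \<eta> where "\<eta> l = \<rho> / real (dual_bound \<rho> l)" for l
  have bound_pos: "0 < dual_bound \<rho> l" for l by (simp add: dual_bound_def)
  have \<eta>_pos: "0 < \<eta> l" for l using \<rho> bound_pos[of l] by (simp add: \<eta>_def)
  have F: "0 \<le> F w \<and> F w \<le> 1" if "w \<in> \<Omega>" for w
    using that f by (auto simp: F_def \<Omega>_def)
  have \<Omega>: "finite \<Omega>" "\<Omega> \<noteq> {}" using finite_carrier by (auto simp: \<Omega>_def)
  have card_\<Omega>: "real (card \<Omega>) = N\<^sup>2"
    by (simp add: \<Omega>_def order_def card_cartesian_product power2_eq_square)
  let ?I = "{..<3::nat}"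
  have K': "real (card ?I) < real K * \<rho>\<^sup>2" using K by simp
  have bound_eq: "regularity_bound (card ?I) \<eta> = atoms_bound \<rho>"
    by (simp add: atoms_bound_def \<eta>_def[abs_def])
  obtain k \<Phi> \<Phi>' where k: "k < K" and \<Phi>: "finite \<Phi>" "card \<Phi> \<le> atoms_bound \<rho> k" "\<Phi> \<subseteq> \<Phi>'"
    and en: "energy \<Omega> F first_coord second_coord ?I \<Phi>' - energy \<Omega> F first_coord second_coord ?I \<Phi>
      \<le> \<rho>\<^sup>2 * real (card \<Omega>)"
    and uni: "cut_uniform \<Omega> F first_coord second_coord ?I (\<eta> (atoms_bound \<rho> k)) \<Phi>'"
    by (rule strong_regularity[where f = F and \<eta> = \<eta> and s = first_coord and t = second_coord and I = ?I,
          OF \<Omega> finite_lessThan \<eta>_pos F K', unfolded bound_eq])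
  define l where "l = atoms_bound \<rho> k"
  obtain \<Gamma> where \<Gamma>: "subgroup \<Gamma> G" "card \<Gamma> \<le> dual_bound \<rho> l"
    and transfer: "\<And>F W. \<lbrakk>\<And>x y z. \<lbrakk>x \<in> U; y \<in> U; z \<in> U\<rbrakk> \<Longrightarrow>
            F x y z = W (atom_of \<Phi> x) (atom_of \<Phi> y) (atom_of \<Phi> z);
          \<And>a b c. \<bar>W a b c\<bar> \<le> 1\<rbrakk> \<Longrightarrow>
        triangle_sum U F - \<rho> * N ^ 3 \<le> triangle_sum \<Gamma> F"
    using spectral_subgroup[OF \<Phi>(1) \<Phi>(2) \<rho>] unfolding l_def by blast
  have \<eta>\<Gamma>: "real (card \<Gamma>) * \<eta> l \<le> \<rho>"
    using \<Gamma>(2) \<rho> bound_pos[of l] by (simp add: \<eta>_def field_simps)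
  define p where "p i = cavg \<Omega> (pair_label (first_coord i) (second_coord i) \<Phi>) F" for i
  define p' where "p' i = cavg \<Omega> (pair_label (first_coord i) (second_coord i) \<Phi>') F" for i
  define fi where "fi i x y = F (point i x y)" for i x y
  define ki where "ki i x y = p i (point i x y)" for i x y
  define ki' where "ki' i x y = p' i (point i x y)" for i x y
  have fi_bound: "\<bar>fi i x y\<bar> \<le> 1" if "x \<in> U" "y \<in> U" for i x y
    using F[of "point i x y"] point_in[OF that, of i] by (simp add: fi_def \<Omega>_def)
  have p_bound: "\<bar>p i w\<bar> \<le> 1" for i w
  proof -
    have "0 \<le> p i w" "p i w \<le> 1" unfolding p_def using F by (auto intro: cavg_nonneg cavg_le_1)
    then show ?thesis by simp
  qed
  then have ki_bound: "\<bar>ki i x y\<bar> \<le> 1" for i x y by (simp add: ki_def)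
  have cut: "(\<Sum>x\<in>U. \<Sum>y\<in>U. (fi i x y - ki' i x y) * a x * b y) \<le> \<eta> l * N\<^sup>2"
    if "i < 3" and ab: "\<forall>x\<in>U. \<bar>a x\<bar> \<le> 1 \<and> \<bar>b x\<bar> \<le> 1" for i a b
  proof -
    have "(\<Sum>x\<in>U. \<Sum>y\<in>U. (fi i x y - ki' i x y) * a x * b y)
        = (\<Sum>w\<in>\<Omega>. (F w - p' i w) * a (first_coord i w) * b (second_coord i w))"
      unfolding fi_def ki'_def \<Omega>_def
      by (rule sum_point[of "\<lambda>w x y. (F w - p' i w) * a x * b y"])
    also have "\<dots> \<le> \<eta> l * real (card \<Omega>)"
      using uni[unfolded cut_uniform_def, rule_format, of i a b] that point_coord
      by (simp add: p'_def l_def \<Omega>_def)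
    finally show ?thesis by (simp add: card_\<Omega>)
  qed
  have L1: "(\<Sum>x\<in>U. \<Sum>y\<in>U. \<bar>ki' i x y - ki i x y\<bar>) \<le> \<rho> * N\<^sup>2" if "i < 3" for i
  proof -
    have "(\<Sum>x\<in>U. \<Sum>y\<in>U. \<bar>ki' i x y - ki i x y\<bar>) = (\<Sum>w\<in>\<Omega>. \<bar>p' i w - p i w\<bar>)"
      unfolding ki_def ki'_def \<Omega>_def by (rule sum_point[of "\<lambda>w x y. \<bar>p' i w - p i w\<bar>"])
    also have "\<dots> \<le> \<rho> * real (card \<Omega>)"
    proof (rule sum_abs_le_of_sum_square_le[OF _ \<rho>])
      show "(\<Sum>w\<in>\<Omega>. (p' i w - p i w)\<^sup>2) \<le> \<rho>\<^sup>2 * real (card \<Omega>)"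
        unfolding p_def p'_def
        by (rule order_trans[OF cavg_diff_le_energy_diff[where I = ?I, OF \<Omega>(1) \<Phi>(3)] en])
          (use that in auto)
    qed
    finally show ?thesis by (simp add: card_\<Omega>)
  qed
  \<comment> \<open>The vertices are treated one at a time. As the replacement concerns the pair
    \<open>(x, y)\<close>, the variables are permuted before the other two vertices are treated.\<close>
  note replace = triangle_sum_replace[OF \<Gamma>(1) \<eta>\<Gamma> cut L1]
  have "triangle_sum \<Gamma> (\<lambda>x y z. ki 0 x y * (fi 2 x z * fi 1 y z)) - 2 * \<rho> * N ^ 3
      \<le> triangle_sum \<Gamma> (\<lambda>x y z. fi 0 x y * (fi 2 x z * fi 1 y z))"
    by (rule replace) (auto simp: fi_bound)
  moreover have "triangle_sum \<Gamma> (\<lambda>x y z. ki 0 x y * (fi 2 x z * ki 1 y z)) - 2 * \<rho> * N ^ 3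
      \<le> triangle_sum \<Gamma> (\<lambda>x y z. ki 0 x y * (fi 2 x z * fi 1 y z))"
  proof -
    have "triangle_sum \<Gamma> (\<lambda>x y z. ki 1 x y * (ki 0 z x * fi 2 z y)) - 2 * \<rho> * N ^ 3
        \<le> triangle_sum \<Gamma> (\<lambda>x y z. fi 1 x y * (ki 0 z x * fi 2 z y))"
      by (rule replace) (auto simp: fi_bound ki_bound)
    then show ?thesis
      using triangle_sum_rotate[of \<Gamma> "\<lambda>x y z. ki 1 x y * (ki 0 z x * fi 2 z y)"]
        triangle_sum_rotate[of \<Gamma> "\<lambda>x y z. fi 1 x y * (ki 0 z x * fi 2 z y)"]
      by (simp add: mult_ac)
  qed
  moreover have "triangle_sum \<Gamma> (\<lambda>x y z. ki 0 x y * (ki 2 x z * ki 1 y z)) - 2 * \<rho> * N ^ 3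
      \<le> triangle_sum \<Gamma> (\<lambda>x y z. ki 0 x y * (fi 2 x z * ki 1 y z))"
  proof -
    have "triangle_sum \<Gamma> (\<lambda>x y z. ki 2 x y * (ki 0 x z * ki 1 z y)) - 2 * \<rho> * N ^ 3
        \<le> triangle_sum \<Gamma> (\<lambda>x y z. fi 2 x y * (ki 0 x z * ki 1 z y))"
      by (rule replace) (auto simp: fi_bound ki_bound)
    then show ?thesis
      using triangle_sum_swap[of \<Gamma> "\<lambda>x y z. ki 2 x y * (ki 0 x z * ki 1 z y)"]
        triangle_sum_swap[of \<Gamma> "\<lambda>x y z. fi 2 x y * (ki 0 x z * ki 1 z y)"]
      by (simp add: mult_ac)
  qed
  moreover have "triangle_sum U (\<lambda>x y z. ki 0 x y * (ki 2 x z * ki 1 y z)) - \<rho> * N ^ 3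
      \<le> triangle_sum \<Gamma> (\<lambda>x y z. ki 0 x y * (ki 2 x z * ki 1 y z))"
  proof -
    \<comment> \<open>The product of averages as a function of the three atoms, by means of representatives.\<close>
    define rep where "rep a = (SOME x. x \<in> U \<and> atom_of \<Phi> x = a)" for a
    have rep: "rep (atom_of \<Phi> x) \<in> U" "atom_of \<Phi> (rep (atom_of \<Phi> x)) = atom_of \<Phi> x" if "x \<in> U" for x
      using someI[of "\<lambda>y. y \<in> U \<and> atom_of \<Phi> y = atom_of \<Phi> x" x] that unfolding rep_def by auto
    have ki_rep: "ki i (rep (atom_of \<Phi> x)) (rep (atom_of \<Phi> y)) = ki i x y" if "x \<in> U" "y \<in> U" for i x y
      unfolding ki_def p_def
      by (rule cavg_cong_label) (simp add: pair_label_def coord_point rep that)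
    show ?thesis
    proof (rule transfer[where W = "\<lambda>a b c. ki 0 (rep a) (rep b) * (ki 2 (rep a) (rep c) * ki 1 (rep b) (rep c))"])
      fix a b c
      have "\<bar>ki 0 (rep a) (rep b)\<bar> * (\<bar>ki 2 (rep a) (rep c)\<bar> * \<bar>ki 1 (rep b) (rep c)\<bar>) \<le> 1"
        by (intro mult_le_one ki_bound) auto
      then show "\<bar>ki 0 (rep a) (rep b) * (ki 2 (rep a) (rep c) * ki 1 (rep b) (rep c))\<bar> \<le> 1"
        by (simp add: abs_mult)
    qed (simp add: ki_rep)
  qed
  moreover have "\<alpha> ^ 4 * N ^ 3 \<le> triangle_sum U (\<lambda>x y z. ki 0 x y * (ki 2 x z * ki 1 y z))"
  proof -
    have mean: "\<alpha> * real (card \<Omega>) \<le> (\<Sum>w\<in>\<Omega>. F w)"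
      using \<alpha>(2) unfolding card_\<Omega> by (simp add: \<Omega>_def F_def sum.cartesian_product)
    have "\<alpha> ^ 4 * real (card \<Omega>) \<le> (\<Sum>w\<in>\<Omega>. p 0 w * p 2 w * p 1 w)"
      unfolding p_def by (rule mean_power4_le_mean_cavg_prod[OF \<Omega>(1) _ \<alpha>(1) mean]) (rule F)
    also have "\<dots> = (\<Sum>x\<in>U. \<Sum>y\<in>U. p 0 (x, y) * p 2 (x, y) * p 1 (x, y))"
      by (simp add: \<Omega>_def sum.cartesian_product split_def)
    also have "\<dots> = (\<Sum>x\<in>U. \<Sum>y\<in>U. ki 0 x y * (ki 2 x (x \<otimes> y) * ki 1 y (x \<otimes> y)))"
      by (intro sum.cong refl) (simp add: ki_def point_def cancel cancel_comm)
    finally have "N * (\<alpha> ^ 4 * N\<^sup>2)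
        \<le> N * (\<Sum>x\<in>U. \<Sum>y\<in>U. ki 0 x y * (ki 2 x (x \<otimes> y) * ki 1 y (x \<otimes> y)))"
      using N_pos by (intro mult_left_mono) (auto simp: card_\<Omega>)
    then show ?thesis
      unfolding triangle_sum_carrier by (simp add: power2_eq_square power3_eq_cube mult_ac)
  qed
  moreover have "triangle_sum \<Gamma> (\<lambda>x y z. fi 0 x y * (fi 2 x z * fi 1 y z))
      = triangle_sum \<Gamma> (\<lambda>x y z. f x y * (f x (x \<otimes> z) * f (y \<otimes> z) y))"
    by (rule triangle_sum_cong) (simp add: fi_def F_def point_def)
  ultimately have "(\<alpha> ^ 4 - 7 * \<rho>) * N ^ 3
      \<le> triangle_sum \<Gamma> (\<lambda>x y z. f x y * (f x (x \<otimes> z) * f (y \<otimes> z) y))"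
    unfolding left_diff_distrib by linarith
  with k \<Gamma> show thesis using that unfolding l_def by blast
qed

text \<open>Substitute \<open>z = x \<otimes> y \<otimes> d\<close>.\<close>

lemma triangle_sum_corners:
  "triangle_sum \<Gamma> (\<lambda>x y z. f x y * (f x (x \<otimes> z) * f (y \<otimes> z) y))
    = (\<Sum>d\<in>U. char_sum \<Gamma> d * (\<Sum>x\<in>U. \<Sum>y\<in>U. f x y * (f x (y \<otimes> d) * f (x \<otimes> d) y)))"
proof -
  have shift: "(\<Sum>z\<in>U. char_sum \<Gamma> (x \<otimes> y \<otimes> z) * (f x y * (f x (x \<otimes> z) * f (y \<otimes> z) y)))
      = (\<Sum>d\<in>U. char_sum \<Gamma> d * (f x y * (f x (y \<otimes> d) * f (x \<otimes> d) y)))"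
    if xy: "x \<in> U" "y \<in> U" for x y
  proof -
    have "(\<Sum>z\<in>U. char_sum \<Gamma> (x \<otimes> y \<otimes> z) * (f x y * (f x (x \<otimes> z) * f (y \<otimes> z) y)))
        = (\<Sum>d\<in>U. char_sum \<Gamma> (x \<otimes> y \<otimes> (x \<otimes> y \<otimes> d)) *
            (f x y * (f x (x \<otimes> (x \<otimes> y \<otimes> d)) * f (y \<otimes> (x \<otimes> y \<otimes> d)) y)))"
      by (rule sum_translate[symmetric]) (use xy in simp)
    also have "\<dots> = (\<Sum>d\<in>U. char_sum \<Gamma> d * (f x y * (f x (y \<otimes> d) * f (x \<otimes> d) y)))"
    proof (intro sum.cong refl)
      fix d assume d: "d \<in> U"
      have "x \<otimes> y \<otimes> (x \<otimes> y \<otimes> d) = d" using xy d by (simp add: cancel)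
      moreover have "x \<otimes> (x \<otimes> y \<otimes> d) = y \<otimes> d" using xy d by (simp add: m_assoc cancel)
      moreover have "y \<otimes> (x \<otimes> y \<otimes> d) = x \<otimes> d"
        using xy d cancel[of y "x \<otimes> d"] by (simp add: m_ac)
      ultimately show "char_sum \<Gamma> (x \<otimes> y \<otimes> (x \<otimes> y \<otimes> d)) *
            (f x y * (f x (x \<otimes> (x \<otimes> y \<otimes> d)) * f (y \<otimes> (x \<otimes> y \<otimes> d)) y))
          = char_sum \<Gamma> d * (f x y * (f x (y \<otimes> d) * f (x \<otimes> d) y))" by simp
    qed
    finally show ?thesis .
  qed
  have "triangle_sum \<Gamma> (\<lambda>x y z. f x y * (f x (x \<otimes> z) * f (y \<otimes> z) y))
      = (\<Sum>x\<in>U. \<Sum>y\<in>U. \<Sum>d\<in>U. char_sum \<Gamma> d * (f x y * (f x (y \<otimes> d) * f (x \<otimes> d) y)))"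
    unfolding triangle_sum_def
    by (rule sum.cong[OF refl], rule sum.cong[OF refl], rule shift)
  also have "\<dots> = (\<Sum>x\<in>U. \<Sum>d\<in>U. \<Sum>y\<in>U. char_sum \<Gamma> d * (f x y * (f x (y \<otimes> d) * f (x \<otimes> d) y)))"
    by (intro sum.cong refl sum.swap)
  also have "\<dots> = (\<Sum>d\<in>U. \<Sum>x\<in>U. \<Sum>y\<in>U. char_sum \<Gamma> d * (f x y * (f x (y \<otimes> d) * f (x \<otimes> d) y)))"
    by (rule sum.swap)
  finally show ?thesis by (simp add: sum_distrib_left)
qed

lemma card_corner_set:
  "real (card (corner_set G A d))
    = (\<Sum>x\<in>U. \<Sum>y\<in>U. of_bool ((x, y) \<in> A)
        * (of_bool ((x, y \<otimes> d) \<in> A) * of_bool ((x \<otimes> d, y) \<in> A)))"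
proof -
  have "real (card (corner_set G A d)) = (\<Sum>w\<in>U \<times> U. of_bool (w \<in> corner_set G A d))"
    using finite_carrier by (auto simp: corner_set_def Int_def intro!: arg_cong[of _ _ card])
  also have "\<dots> = (\<Sum>x\<in>U. \<Sum>y\<in>U. of_bool ((x, y) \<in> corner_set G A d))"
    by (simp add: sum.cartesian_product split_def)
  also have "\<dots> = (\<Sum>x\<in>U. \<Sum>y\<in>U. of_bool ((x, y) \<in> A)
        * (of_bool ((x, y \<otimes> d) \<in> A) * of_bool ((x \<otimes> d, y) \<in> A)))"
    by (intro sum.cong refl) (auto simp: corner_set_def)
  finally show ?thesis .
qed

text \<open>Beyond the loss \<open>7 \<rho>\<close> of \<open>weighted_corners_lower\<close>, a further \<open>\<rho>\<close> accounts for the trivial corners,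
  whose weight is \<open>card \<Gamma>\<close> out of a total of \<open>N\<close>, and the last one makes the inequality strict.\<close>

lemma popular_corner:
  assumes A: "A \<subseteq> U \<times> U" "\<alpha> \<le> pair_density G A" and \<alpha>: "0 \<le> \<alpha>"
    and \<rho>: "0 < \<rho>" and K: "3 < real K * \<rho>\<^sup>2"
    and large: "2 \<le> order G" "\<And>k. k < K \<Longrightarrow> real (dual_bound \<rho> (atoms_bound \<rho> k)) \<le> \<rho> * N"
  shows "\<exists>d\<in>U - {\<one>}. (\<alpha> ^ 4 - 9 * \<rho>) * N\<^sup>2 < real (card (corner_set G A d))"
proof (rule ccontr)
  define f :: "'a \<Rightarrow> 'a \<Rightarrow> real" where "f x y = of_bool ((x, y) \<in> A)" for x y
  define c where "c = \<alpha> ^ 4 - 9 * \<rho>"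
  assume "\<not> ?thesis"
  then have small: "real (card (corner_set G A d)) \<le> c * N\<^sup>2" if "d \<in> U - {\<one>}" for d
    using that by (auto simp: c_def not_less)
  \<comment> \<open>Needed to extend the sum over \<open>d \<noteq> \<one>\<close> to all \<open>d\<close> below.\<close>
  have "0 \<le> c"
  proof -
    have "\<not> U \<subseteq> {\<one>}" using large(1) card_mono[of "{\<one>}" U] by (auto simp: order_def)
    then obtain d where "d \<in> U - {\<one>}" by blast
    then have "0 \<le> c * N\<^sup>2" using small[of d] by linarith
    then show ?thesis using N_pos by (simp add: zero_le_mult_iff)
  qed
  have "real (card A) = (\<Sum>w\<in>U \<times> U. of_bool (w \<in> A))"
    using finite_carrier A(1) by (auto intro!: arg_cong[of _ _ card])
  also have "\<dots> = (\<Sum>x\<in>U. \<Sum>y\<in>U. f x y)"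
    by (simp add: f_def sum.cartesian_product split_def)
  finally have "\<alpha> * N\<^sup>2 \<le> (\<Sum>x\<in>U. \<Sum>y\<in>U. f x y)"
    using A(2) N_pos by (simp add: pair_density_def pos_le_divide_eq)
  moreover have "0 \<le> f x y \<and> f x y \<le> 1" for x y by (simp add: f_def)
  ultimately obtain k \<Gamma> where k: "k < K" and \<Gamma>: "subgroup \<Gamma> G" "card \<Gamma> \<le> dual_bound \<rho> (atoms_bound \<rho> k)"
    and lower: "(\<alpha> ^ 4 - 7 * \<rho>) * N ^ 3
      \<le> triangle_sum \<Gamma> (\<lambda>x y z. f x y * (f x (x \<otimes> z) * f (y \<otimes> z) y))"
    using weighted_corners_lower[of f, OF _ \<alpha> _ \<rho> K] by blast
  have \<Gamma>U: "\<Gamma> \<subseteq> U" by (rule subgroup.subset[OF \<Gamma>(1)])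
  note lower
  also have "triangle_sum \<Gamma> (\<lambda>x y z. f x y * (f x (x \<otimes> z) * f (y \<otimes> z) y))
      = (\<Sum>d\<in>U. char_sum \<Gamma> d * real (card (corner_set G A d)))"
    unfolding triangle_sum_corners card_corner_set by (simp add: f_def)
  also have "\<dots> = char_sum \<Gamma> \<one> * real (card (corner_set G A \<one>))
      + (\<Sum>d\<in>U - {\<one>}. char_sum \<Gamma> d * real (card (corner_set G A d)))"
    using finite_carrier by (intro sum.remove) auto
  also have "\<dots> \<le> \<rho> * N * N\<^sup>2 + (\<Sum>d\<in>U - {\<one>}. char_sum \<Gamma> d * (c * N\<^sup>2))"
  proof (intro add_mono mult_mono sum_mono)
    show "char_sum \<Gamma> \<one> \<le> \<rho> * N"
    proof -
      have "char_sum \<Gamma> \<one> = real (card \<Gamma>)"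
        unfolding char_sum_def using \<Gamma>U by (simp add: e_one subsetD)
      then show ?thesis using \<Gamma>(2) large(2)[OF k] by linarith
    qed
    show "real (card (corner_set G A \<one>)) \<le> N\<^sup>2"
    proof -
      have "card (corner_set G A \<one>) \<le> card (U \<times> U)"
        using finite_carrier by (intro card_mono) (auto simp: corner_set_def)
      then show ?thesis
        by (simp add: order_def card_cartesian_product power2_eq_square flip: of_nat_mult)
    qed
  qed (use small \<rho> N_pos char_sum_nonneg[OF \<Gamma>(1)] in auto)
  also have "\<dots> \<le> \<rho> * N * N\<^sup>2 + (\<Sum>d\<in>U. char_sum \<Gamma> d * (c * N\<^sup>2))"
    using finite_carrier \<open>0 \<le> c\<close> N_pos char_sum_nonneg[OF \<Gamma>(1)]
    by (intro add_left_mono sum_mono2) auto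
  also have "\<dots> = (\<rho> + c) * N ^ 3"
    using sum_char_sum[OF \<Gamma>U subgroup.one_closed[OF \<Gamma>(1)]]
    by (simp add: power2_eq_square power3_eq_cube algebra_simps flip: sum_distrib_left sum_distrib_right)
  finally have "\<rho> * N ^ 3 \<le> 0" by (simp add: c_def algebra_simps)
  then show False using \<rho> N_pos by (simp add: mult_le_0_iff)
qed

end

section \<open>The standard pairing on vectors over the field with two elements\<close>

definition F2_pairing :: "nat \<Rightarrow> (nat \<Rightarrow> int) \<Rightarrow> (nat \<Rightarrow> int) \<Rightarrow> real" where
  "F2_pairing n r x = (\<Prod>i<n. if r i = 1 \<and> x i = 1 then - 1 else 1)"

lemma carrier_F2_power: "carrier (F2_power n) = (\<Pi>\<^sub>E i\<in>{..<n}. {0, 1})"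
proof -
  have "{0..<2::int} = {0, 1}" by auto
  then show ?thesis by (simp add: F2_power_def carrier_integer_mod_group)
qed

lemma mult_F2_power: "x \<otimes>\<^bsub>F2_power n\<^esub> y = (\<lambda>i\<in>{..<n}. (x i + y i) mod 2)"
  by (simp add: F2_power_def)

lemma one_F2_power: "\<one>\<^bsub>F2_power n\<^esub> = (\<lambda>i\<in>{..<n}. 0)"
  by (simp add: F2_power_def)

lemma self_dual_F2_power: "self_dual_two_group (F2_power n) (F2_pairing n)"
proof -
  interpret comm_group "F2_power n" by (rule comm_group_F2_power)
  have bit: "r i = 0 \<or> r i = 1" if "r \<in> carrier (F2_power n)" "i < n" for r i
    using PiE_mem[of r "{..<n}" "\<lambda>_. {0, 1}" i] that by (auto simp: carrier_F2_power)
  show ?thesis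
  proof
    fix r x y
    assume r: "r \<in> carrier (F2_power n)"
    show "r \<otimes>\<^bsub>F2_power n\<^esub> r = \<one>\<^bsub>F2_power n\<^esub>"
      using bit[OF r] by (auto simp: mult_F2_power one_F2_power restrict_def fun_eq_iff)
    show "F2_pairing n r x = 1 \<or> F2_pairing n r x = - 1"
      unfolding F2_pairing_def by (induction n) auto
    show "\<exists>x\<in>carrier (F2_power n). F2_pairing n r x \<noteq> 1" if ne: "r \<noteq> \<one>\<^bsub>F2_power n\<^esub>"
    proof -
      have "\<exists>j<n. r j = 1"
      proof (rule ccontr)
        assume "\<not> ?thesis"
        then have "\<And>j. j < n \<Longrightarrow> r j = 0" using bit[OF r] by blast
        then have "r = \<one>\<^bsub>F2_power n\<^esub>"
          using r by (intro PiE_ext[of r "{..<n}" "\<lambda>_. {0, 1}"]) (auto simp: carrier_F2_power one_F2_power)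
        with ne show False by simp
      qed
      then obtain j where j: "j < n" "r j = 1" by blast
      let ?x = "\<lambda>i\<in>{..<n}. if i = j then 1 else 0 :: int"
      have "F2_pairing n r ?x = (\<Prod>i<n. if i = j then - 1 else 1)"
        unfolding F2_pairing_def by (intro prod.cong refl) (use j in auto)
      also have "\<dots> = - 1" using j by (simp add: prod.delta)
      finally show ?thesis by (intro bexI[of _ ?x]) (auto simp: carrier_F2_power)
    qed
    show "F2_pairing n r (x \<otimes>\<^bsub>F2_power n\<^esub> y) = F2_pairing n r x * F2_pairing n r y"
      if x: "x \<in> carrier (F2_power n)" and y: "y \<in> carrier (F2_power n)"
      unfolding F2_pairing_def prod.distrib[symmetric]
    proof (intro prod.cong refl)
      fix i assume "i \<in> {..<n}"
      then show "(if r i = 1 \<and> (x \<otimes>\<^bsub>F2_power n\<^esub> y) i = 1 then - 1 else 1 :: real)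
          = (if r i = 1 \<and> x i = 1 then - 1 else 1) * (if r i = 1 \<and> y i = 1 then - 1 else 1)"
        using bit[OF x, of i] bit[OF y, of i] by (auto simp: mult_F2_power)
    qed
  next
    show "F2_pairing n r x = F2_pairing n x r" for r x
      unfolding F2_pairing_def by (intro prod.cong refl) auto
  qed (rule finite_F2_power)
qed

theorem mainTheorem6:
  fixes \<alpha> :: real
  assumes "0 \<le> \<alpha>" and "\<alpha> \<le> 1"
  shows "threshold_density {F2_power n | n. n \<ge> 1} \<alpha> \<ge> \<alpha> ^ 4"
proof (rule threshold_density_greatest(4))
  show "0 \<le> \<alpha> ^ 4" "\<alpha> ^ 4 \<le> 1" using assms by (auto intro: power_le_one)
  show "popular_corners {F2_power n | n. n \<ge> 1} \<alpha> (\<alpha> ^ 4)"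
    unfolding popular_corners_def
  proof (intro allI impI)
    fix \<epsilon> :: real assume "0 < \<epsilon>"
    define \<rho> where "\<rho> = \<epsilon> / 9"
    have \<rho>: "0 < \<rho>" using \<open>0 < \<epsilon>\<close> by (simp add: \<rho>_def)
    define K where "K = nat \<lfloor>3 / \<rho>\<^sup>2\<rfloor> + 1"
    have "3 / \<rho>\<^sup>2 < real K" unfolding K_def by linarith
    then have K: "3 < real K * \<rho>\<^sup>2" using \<rho> by (simp add: pos_divide_less_eq)
    define m where "m k = real (dual_bound \<rho> (atoms_bound \<rho> k))" for k
    define N\<^sub>0 where "N\<^sub>0 = max 2 (nat \<lceil>(\<Sum>k<K. m k) / \<rho>\<rceil>)"
    show "\<exists>N\<^sub>0. \<forall>G\<in>{F2_power n | n. n \<ge> 1}. order G \<ge> N\<^sub>0 \<longrightarrow>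
      (\<forall>A. A \<subseteq> carrier G \<times> carrier G \<and> pair_density G A \<ge> \<alpha> \<longrightarrow>
        (\<exists>d \<in> carrier G - {\<one>\<^bsub>G\<^esub>}.
           real (card (corner_set G A d)) > (\<alpha> ^ 4 - \<epsilon>) * real (order G) ^ 2))"
    proof (intro exI[of _ N\<^sub>0] ballI impI allI, elim conjE)
      fix G A
      assume "G \<in> {F2_power n | n. n \<ge> 1}" and ord: "N\<^sub>0 \<le> order G"
        and A: "A \<subseteq> carrier G \<times> carrier G" "\<alpha> \<le> pair_density G A"
      then obtain n where "G = F2_power n" by blast
      then interpret self_dual_two_group G "F2_pairing n" by (simp add: self_dual_F2_power)
      have "m k \<le> \<rho> * real (order G)" if "k < K" for k
      proof -
        have "m k \<le> (\<Sum>k<K. m k)"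
          by (rule member_le_sum) (use that in \<open>auto simp: m_def\<close>)
        moreover have "(\<Sum>k<K. m k) / \<rho> \<le> real (order G)"
          using ord unfolding N\<^sub>0_def by linarith
        ultimately show ?thesis using \<rho> by (simp add: pos_divide_le_eq mult.commute)
      qed
      then have "\<exists>d\<in>carrier G - {\<one>\<^bsub>G\<^esub>}.
          (\<alpha> ^ 4 - 9 * \<rho>) * (real (order G))\<^sup>2 < real (card (corner_set G A d))"
        using ord by (intro popular_corner[OF A assms(1) \<rho> K]) (auto simp: m_def N\<^sub>0_def)
      then show "\<exists>d\<in>carrier G - {\<one>\<^bsub>G\<^esub>}.
          (\<alpha> ^ 4 - \<epsilon>) * (real (order G))\<^sup>2 < real (card (corner_set G A d))"
        by (simp add: \<rho>_def)
    qed
  qed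
qed

end
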